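(* Let $G$ be a connected graph, and let $G'$ be a graph resulting from $G$ by a tree shift. Then $\gamma(\mathcal{B}(G')) \le \gamma(\mathcal{B}(G))$.
   Context: Graphs are finite, with no loops or multiple edges; the vertices of a graph with $n$ vertices are labelled distinctly by $[n]=\{1,\dots,n\}$. A leaf of a graph is a vertex of degree one. Graphical building set: $\mathcal{B}(G)$ is the set of all non-empty subsets $I\subseteq[n]$ such that the induced subgraph of $G$ on $I$ is connected. Graph-associahedron: let $e_1,\dots,e_n$ be the endpoints of the coordinate vectors in $\mathbb{R}^n$, and for $I\subseteq[n]$ let $\Delta_I=\mathrm{ConvexHull}(e_i \mid i\in I)$. The graph-associahedron of $G$ is the Minkowski sum $P_{\mathcal{B}(G)}=\sum_{I\in\mathcal{B}(G)}\Delta_I$. It is a simple polytope of dimension $n$ minus the number of connected components of $G$. $\gamma$-polynomial: for a simple $d$-dimensional polytope $P$, let $f(P)(t)=f_0+f_1t+\cdots+f_dt^d$, where $f_i$ is the number of $i$-dimensional faces of $P$. Define $h(P)(t)=\sum_{i=0}^d h_it^i$ by $h(P)(t+1)=f(P)(t)$. This polynomial is symmetric, so it can be written uniquely as $\sum_{i=0}^{d}h_it^i=\sum_{i=0}^{\lfloor d/2\rfloor}\gamma_i t^i(1+t)^{d-2i}$ with $\gamma_i\in\mathbb{Z}$. Set $\gamma(P)(t)=\gamma_0+\gamma_1t+\cdots+\gamma_{\lfloor d/2\rfloor}t^{\lfloor d/2\rfloor}$ and $\gamma(\mathcal{B}(G))=\gamma(P_{\mathcal{B}(G)})$. The notation $\gamma(\mathcal{B})\le\gamma(\mathcal{B}')$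 means that for all $i$ the coefficient of $t^i$ in $\gamma(\mathcal{B})$ is at most the coefficient of $t^i$ in $\gamma(\mathcal{B}')$. Tree shift: let $G$ be a connected graph with the following properties and data. (1) $G$ has a leaf $l$; the nearest vertex to $l$ of degree greater than $2$ is called $c$, and the vertices in the path from $c$ to $l$ are, in order, $c,c_1,c_2,\dots,c_k,l$ (with $k\ge 0$). (2) There is a set $F$ of vertices of $G-\{c,c_1,\dots,c_k,l\}$ such that the subgraph of $G$ on $F\cup\{c\}$ is a tree, and such that no vertex of $G-(\{c\}\cup F)$ is adjacent to a vertex in $F$. (3) The set $E=G-(F\cup\{c,c_1,\dots,c_k,l\})$ of remaining vertices is non-empty. The tree shift of $G$ (with respect to these data) is the graph obtained from $G$ by removing every edge $(v,c)$ with $v\in F$ and replacing it with the edge $(v,l)$. *)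

theory Defs
  imports "HOL-Analysis.Analysis" "HOL-Computational_Algebra.Polynomial"
begin

section \<open>Finite simple graphs\<close>

text \<open>
  A graph on \<open>n\<close> vertices is given by its adjacency relation on a finite index type
  \<open>'n\<close> with \<open>n = CARD('n)\<close>. The type plays the role of the label set \<open>{1,...,n}\<close>: every
  element of it is a vertex, and each edge occurs in both orientations.
\<close>

definition simple_graph :: "'n rel \<Rightarrow> bool" where
  "simple_graph G \<longleftrightarrow> sym G \<and> irrefl G"

definition vertex_degree :: "'n rel \<Rightarrow> 'n \<Rightarrow> nat" where
  "vertex_degree G v = card {w. (v, w) \<in> G}"

definition leaf :: "'n rel \<Rightarrow> 'n \<Rightarrow> bool" where
  "leaf G v \<longleftrightarrow> vertex_degree G v = 1"

definition induced_connected :: "'n rel \<Rightarrow> 'n set \<Rightarrow> bool" where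
  "induced_connected G S \<longleftrightarrow>
     S \<noteq> {} \<and> (\<forall>u\<in>S. \<forall>v\<in>S. (u, v) \<in> (G \<inter> S \<times> S)\<^sup>*)"

definition connected_graph :: "'n rel \<Rightarrow> bool" where
  "connected_graph G \<longleftrightarrow> induced_connected G UNIV"

definition graph_path :: "'n rel \<Rightarrow> 'n list \<Rightarrow> bool" where
  "graph_path G xs \<longleftrightarrow> distinct xs \<and> successively (\<lambda>u v. (u, v) \<in> G) xs"

text \<open>A cycle is listed without repeating its starting vertex.\<close>

definition graph_cycle :: "'n rel \<Rightarrow> 'n list \<Rightarrow> bool" where
  "graph_cycle G xs \<longleftrightarrow> length xs \<ge> 3 \<and> graph_path G xs \<and> (last xs, hd xs) \<in> G"

definition induced_tree :: "'n rel \<Rightarrow> 'n set \<Rightarrow> bool" where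
  "induced_tree G S \<longleftrightarrow>
     induced_connected G S \<and> \<not> (\<exists>xs. graph_cycle (G \<inter> S \<times> S) xs)"

text \<open>The distance is meaningful only between vertices in the same component.\<close>

definition graph_dist :: "'n rel \<Rightarrow> 'n \<Rightarrow> 'n \<Rightarrow> nat" where
  "graph_dist G u v = (LEAST k. (u, v) \<in> G ^^ k)"


section \<open>Graph-associahedra\<close>

definition building_set :: "'n rel \<Rightarrow> 'n set set" where
  "building_set G = {I. induced_connected G I}"

definition simplex_on :: "'n::finite set \<Rightarrow> (real ^ 'n) set" where
  "simplex_on I = convex hull ((\<lambda>i. axis i 1) ` I)"

text \<open>
  Addition of sets is elementwise, so the sum below is the Minkowski sum.
\<close>

definition graph_associahedron :: "('n::finite) rel \<Rightarrow> (real ^ 'n) set" where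
  "graph_associahedron G = (\<Sum>I\<in>building_set G. simplex_on I)"


section \<open>The f-, h- and gamma-polynomials of a simple polytope\<close>

definition poly_dim :: "'a::euclidean_space set \<Rightarrow> nat" where
  "poly_dim P = nat (aff_dim P)"

definition face_number :: "'a::euclidean_space set \<Rightarrow> nat \<Rightarrow> nat" where
  "face_number P i = card {F. F face_of P \<and> aff_dim F = int i}"

definition f_poly :: "'a::euclidean_space set \<Rightarrow> int poly" where
  "f_poly P = (\<Sum>i\<le>poly_dim P. monom (int (face_number P i)) i)"

text \<open>The defining equation is \<open>h(t + 1) = f(t)\<close>.\<close>

definition h_poly :: "'a::euclidean_space set \<Rightarrow> int poly" where
  "h_poly P = (THE h. pcompose h [:1, 1:] = f_poly P)"

definition gamma_expansion :: "nat \<Rightarrow> int poly \<Rightarrow> int poly" where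
  "gamma_expansion d g =
     (\<Sum>i\<le>d div 2. smult (coeff g i) (monom 1 i * [:1, 1:] ^ (d - 2 * i)))"

text \<open>
  The description is proper whenever \<open>h_poly P\<close> is symmetric, in particular for every simple
  polytope \<open>P\<close>.
\<close>

definition gamma_poly :: "'a::euclidean_space set \<Rightarrow> int poly" where
  "gamma_poly P =
     (THE g. degree g \<le> poly_dim P div 2 \<and> h_poly P = gamma_expansion (poly_dim P) g)"

lemma pcompose_shift_iff:
  fixes h f :: "int poly"
  shows "pcompose h [:1, 1:] = f \<longleftrightarrow> h = pcompose f [:-1, 1:]"
proof -
  have "pcompose (pcompose h [:1, 1:]) [:-1, 1:] = h"
    "pcompose (pcompose f [:-1, 1:]) [:1, 1:] = f"
    by (simp_all add: pcompose_assoc [symmetric] pcompose_pCons pcompose_idR)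
  then show ?thesis by metis
qed

lemma h_poly_eq: "h_poly P = pcompose (f_poly P) [:-1, 1:]"
  by (simp add: h_poly_def pcompose_shift_iff)

lemma gamma_expansion_inject:
  assumes "degree g \<le> d div 2" "degree g' \<le> d div 2"
    and eq: "gamma_expansion d g = gamma_expansion d g'"
  shows "g = g'"
proof -
  have low: "coeff (gamma_expansion d g) k =
      coeff g k + (\<Sum>i<k. coeff g i * coeff ([:1, 1:] ^ (d - 2 * i)) (k - i))"
    if "k \<le> d div 2" for k and g :: "int poly"
  proof -
    have "coeff (gamma_expansion d g) k = (\<Sum>i\<le>d div 2.
        if i \<le> k then coeff g i * coeff ([:1, 1:] ^ (d - 2 * i)) (k - i) else 0)"
      unfolding gamma_expansion_def coeff_sum
      by (intro sum.cong) (auto simp: coeff_monom_mult)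
    also have "\<dots> = (\<Sum>i\<le>k. coeff g i * coeff ([:1, 1:] ^ (d - 2 * i)) (k - i))"
      using that by (intro sum.mono_neutral_cong_right) auto
    finally show ?thesis
      by (simp add: lessThan_Suc_atMost [symmetric] coeff_0_power)
  qed
  have "coeff g k = coeff g' k" for k
  proof (induction k rule: less_induct)
    case (less k)
    show ?case
    proof (cases "k \<le> d div 2")
      case True
      then show ?thesis using low [OF True, of g] low [OF True, of g'] eq less by simp
    next
      case False
      then show ?thesis using assms by (simp add: coeff_eq_0)
    qed
  qed
  then show ?thesis by (simp add: poly_eq_iff)
qed


section \<open>Tree shifts\<close>

text \<open>
  \<open>cs\<close> is the (possibly empty) list \<open>c\<^sub>1, ..., c\<^sub>k\<close>. The path from \<open>c\<close> to \<open>l\<close> is unique, since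
  \<open>c\<close> is the nearest vertex to \<open>l\<close> of degree greater than 2.
\<close>

definition tree_shift_data :: "'n rel \<Rightarrow> 'n \<Rightarrow> 'n list \<Rightarrow> 'n \<Rightarrow> 'n set \<Rightarrow> bool" where
  "tree_shift_data G c cs l F \<longleftrightarrow>
     leaf G l \<and>
     vertex_degree G c > 2 \<and>
     (\<forall>v. vertex_degree G v > 2 \<longrightarrow> graph_dist G l c \<le> graph_dist G l v) \<and>
     graph_path G (c # cs @ [l]) \<and>
     F \<inter> set (c # cs @ [l]) = {} \<and>
     induced_tree G (insert c F) \<and>
     (\<forall>u v. u \<notin> insert c F \<and> v \<in> F \<longrightarrow> (u, v) \<notin> G) \<and>
     UNIV - (F \<union> set (c # cs @ [l])) \<noteq> {}"

definition shift_edges :: "'n rel \<Rightarrow> 'n \<Rightarrow> 'n \<Rightarrow> 'n set \<Rightarrow> 'n rel" where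
  "shift_edges G c l F =
     (G - (F \<times> {c} \<union> {c} \<times> F))
     \<union> {(v, l) |v. v \<in> F \<and> (v, c) \<in> G} \<union> {(l, v) |v. v \<in> F \<and> (v, c) \<in> G}"

definition tree_shift :: "'n rel \<Rightarrow> 'n rel \<Rightarrow> bool" where
  "tree_shift G G' \<longleftrightarrow>
     (\<exists>c cs l F. tree_shift_data G c cs l F \<and> G' = shift_edges G c l F)"

end

theory Submission
  imports Defs
begin

text \<open>
For a graph \<open>R\<close> and a vertex set \<open>S\<close> let \<open>h(R, S)\<close> be the h-polynomial and \<open>\<gamma>(R, S)\<close> the
gamma-polynomial of the graph-associahedron of the subgraph of \<open>R\<close> induced on \<open>S\<close>; below these
are \<open>hpol R S\<close> and \<open>gam R S\<close>.

\<^bold>\<open>Faces.\<close> The face of a Minkowski sum of simplices \<open>\<Delta>\<^sub>I\<close> on which a functional \<open>w\<close> is maximal is the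
sum of the simplices on the sets of maximizers of \<open>w\<close> in \<open>I\<close>. So the faces are the families
\<open>I \<mapsto> argmax\<^sub>I w\<close>, indexed by the connected sets \<open>I\<close>. If \<open>S\<close> is connected, such a family consists of
the maximizers in \<open>S\<close>, with complement \<open>T \<subset> S\<close>, and an arbitrary family on \<open>T\<close>. This gives
\<open>h(R, S) = (\<Sum>T \<subset> S. (t - 1) ^ (|S| - |T| - 1) * h(R, T))\<close>, and \<open>h\<close> is multiplicative over
components. The two rules determine \<open>h\<close>.

\<^bold>\<open>Adding an edge.\<close> Let \<open>R'\<close> be \<open>R\<close> with an edge \<open>u v\<close> added. Expanding both sides by the recursion
proves (\<open>hpol_add_edge\<close>)

  \<open>h(R', S) = h(R, S) + t * (\<Sum>(C, D). h(R, C) * h(R, D) * h(R' / (C \<union> D), S - (C \<union> D)))\<close>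

where \<open>C \<ni> u\<close> and \<open>D \<ni> v\<close> are connected and there is no edge of \<open>R\<close> between them, that is,
\<open>C \<union> D\<close> runs through the connected sets of \<open>R'\<close> in which \<open>u v\<close> is a bridge. The polynomial \<open>\<gamma>\<close>
satisfies the same equation (\<open>gam_add_edge\<close>), except that a pair for which \<open>C \<union> D\<close> is a whole
component is left out: its summand is \<open>h(R, S)\<close> itself, and together with the leading term it
produces the factor \<open>1 + t\<close> which accounts for the dimension going up by one. By induction on the
edges, \<open>\<gamma>\<close> exists, has non-negative coefficients and increases when edges are added.

\<^bold>\<open>The shift.\<close> Both graphs arise from a graph \<open>Q\<close> with a pendant path from \<open>a\<close> to \<open>b\<close> by hanging one
and the same graph on the vertex \<open>a\<close> or on the vertex \<open>b\<close>. Remove an edge \<open>u v\<close> of \<open>Q\<close> that is not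
on the path and compare the two sums (\<open>gam_hang_le\<close>). A pair \<open>(C, D)\<close> that occurs for \<open>b\<close> also
occurs for \<open>a\<close>, and each of its three factors for \<open>b\<close> is bounded by the one for \<open>a\<close>. The induced
subgraphs are equal or again of the form considered. If \<open>C \<union> D\<close> contains \<open>b\<close>, it contains \<open>a\<close>, and
the two contractions coincide. If not, contracting \<open>C \<union> D\<close> swallows an initial segment of the path,
possibly empty; in the graph for \<open>b\<close> this leaves the hanging graph at the end of the remaining path,
whereas in the graph for \<open>a\<close> it makes the hanging graph adjacent to the beginning of the remaining
path, up to additional edges that only increase \<open>\<gamma>\<close>. So induction applies in all cases. Once \<open>Q\<close>
has no edges off the path, reversing the path is an isomorphism between the two graphs.
\<close>

section \<open>Connected vertex sets\<close>

lemma induced_connected_cong: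
  assumes "R \<inter> S \<times> S = R' \<inter> S \<times> S"
  shows "induced_connected R S \<longleftrightarrow> induced_connected R' S"
  using assms by (simp add: induced_connected_def)

lemma rel_cong_subset:
  assumes "R \<inter> S \<times> S = R' \<inter> S \<times> S" "T \<subseteq> S"
  shows "R \<inter> T \<times> T = R' \<inter> T \<times> T"
  using assms by blast

lemma induced_connected_nonempty: "induced_connected R S \<Longrightarrow> S \<noteq> {}"
  by (simp add: induced_connected_def)

lemma induced_connectedI_root:
  assumes "sym R" "r \<in> S" "\<And>v. v \<in> S \<Longrightarrow> (r, v) \<in> (R \<inter> S \<times> S)\<^sup>*"
  shows "induced_connected R S"
proof -
  have "sym ((R \<inter> S \<times> S)\<^sup>*)"
    using assms(1) by (intro sym_rtrancl) (auto simp: sym_def)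
  then have "(u, v) \<in> (R \<inter> S \<times> S)\<^sup>*" if "u \<in> S" "v \<in> S" for u v
    using assms(3)[OF that(1)] assms(3)[OF that(2)] by (meson rtrancl_trans symD)
  then show ?thesis using assms(2) unfolding induced_connected_def by blast
qed

text \<open>
A walk from \<open>Z\<close> to its complement has a first step that leaves \<open>Z\<close>. Most uses of connectedness below
need no more about walks than this.
\<close>

lemma induced_connected_crossing:
  assumes "induced_connected R S" "x \<in> S" "x \<in> Z" "y \<in> S" "y \<notin> Z"
  shows "\<exists>a b. (a, b) \<in> R \<and> a \<in> S \<and> a \<in> Z \<and> b \<in> S \<and> b \<notin> Z"
proof -
  have "(x, y) \<in> (R \<inter> S \<times> S)\<^sup>*"
    using assms by (simp add: induced_connected_def)
  then have "\<exists>a b. (a, b) \<in> R \<inter> S \<times> S \<and> a \<in> Z \<and> b \<notin> Z"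
    using assms(3,5) by (induction rule: rtrancl_induct) blast+
  then show ?thesis by blast
qed

lemma induced_connectedI_crossing:
  assumes "sym R" "S \<noteq> {}"
    and cross: "\<And>Z. Z \<subseteq> S \<Longrightarrow> Z \<noteq> {} \<Longrightarrow> Z \<noteq> S \<Longrightarrow> \<exists>a\<in>Z. \<exists>b\<in>S - Z. (a, b) \<in> R"
  shows "induced_connected R S"
proof -
  obtain r where r: "r \<in> S" using assms(2) by blast
  define Z where "Z = {v. (r, v) \<in> (R \<inter> S \<times> S)\<^sup>*}"
  have "Z \<subseteq> S"
    using r by (auto simp: Z_def elim: rtranclE)
  moreover have "r \<in> Z" by (simp add: Z_def)
  moreover have "b \<in> Z" if "a \<in> Z" "b \<in> S" "(a, b) \<in> R" for a b
    using that \<open>Z \<subseteq> S\<close> by (auto simp: Z_def intro: rtrancl_into_rtrancl)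
  ultimately have "Z = S" using cross[of Z] by blast
  then show ?thesis
    using assms(1) r by (intro induced_connectedI_root[of R r]) (auto simp: Z_def)
qed

definition separated :: "'n rel \<Rightarrow> 'n set \<Rightarrow> 'n set \<Rightarrow> bool" where
  "separated R A B \<longleftrightarrow> A \<inter> B = {} \<and> R \<inter> A \<times> B = {}"

lemma separated_sym: "sym R \<Longrightarrow> separated R A B \<Longrightarrow> separated R B A"
  by (auto simp: separated_def sym_def)

lemma separated_mono: "separated R A B \<Longrightarrow> A' \<subseteq> A \<Longrightarrow> B' \<subseteq> B \<Longrightarrow> separated R A' B'"
  by (auto simp: separated_def)

lemma connected_in_separated:
  assumes "separated R A B" "induced_connected R I" "I \<subseteq> A \<union> B" "x \<in> I" "x \<in> A"
  shows "I \<subseteq> A"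
proof
  fix y assume "y \<in> I"
  show "y \<in> A"
  proof (rule ccontr)
    assume "y \<notin> A"
    then obtain a b where "(a, b) \<in> R" "a \<in> A" "b \<in> I" "b \<notin> A"
      using induced_connected_crossing[OF assms(2,4,5) \<open>y \<in> I\<close>] by metis
    then show False using assms(1,3) by (auto simp: separated_def)
  qed
qed

lemma component_exists:
  assumes "sym R" "u \<in> S"
  obtains A where "u \<in> A" "A \<subseteq> S" "induced_connected R A" "separated R A (S - A)"
proof -
  define A where "A = {v. (u, v) \<in> (R \<inter> S \<times> S)\<^sup>*}"
  have sub: "A \<subseteq> S" using assms(2) by (auto simp: A_def elim: rtranclE)
  have u: "u \<in> A" by (simp add: A_def)
  have closed: "b \<in> A" if "a \<in> A" "b \<in> S" "(a, b) \<in> R" for a b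
    using that sub by (auto simp: A_def intro: rtrancl_into_rtrancl)
  have "(u, v) \<in> (R \<inter> A \<times> A)\<^sup>*" if "(u, v) \<in> (R \<inter> S \<times> S)\<^sup>*" for v
    using that
  proof (induction rule: rtrancl_induct)
    case (step y z)
    then have "(y, z) \<in> R \<inter> A \<times> A" by (auto simp: A_def intro: rtrancl_into_rtrancl)
    with step.IH show ?case by (rule rtrancl_into_rtrancl)
  qed simp
  then have "induced_connected R A"
    using assms(1) u by (intro induced_connectedI_root[of R u]) (auto simp: A_def)
  moreover have "separated R A (S - A)" using closed by (auto simp: separated_def)
  ultimately show thesis using that u sub by blast
qed

lemma not_connected_separation:
  assumes "sym R" "S \<noteq> {}" "\<not> induced_connected R S"
  obtains A B where "A \<noteq> {}" "B \<noteq> {}" "S = A \<union> B" "separated R A B"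
proof -
  obtain u where u: "u \<in> S" using assms(2) by blast
  obtain A where A: "u \<in> A" "A \<subseteq> S" "induced_connected R A" "separated R A (S - A)"
    using component_exists[OF assms(1) u] by metis
  moreover from A assms(3) have "A \<noteq> S" by blast
  ultimately show thesis using that[of A "S - A"] by blast
qed

section \<open>Contractions\<close>

text \<open>
  For connected \<open>I\<close> this is the reconnected complement: \<open>J\<close> is connected in it iff \<open>J\<close> or
  \<open>J \<union> I\<close> is connected in \<open>R\<close>.
\<close>

definition contraction :: "'n rel \<Rightarrow> 'n set \<Rightarrow> 'n rel" where
  "contraction R I = {(x, y). x \<notin> I \<and> y \<notin> I \<and> x \<noteq> y \<and>
     ((x, y) \<in> R \<or> x \<in> R `` I \<and> y \<in> R `` I)}"

lemma sym_contraction: "sym R \<Longrightarrow> sym (contraction R I)"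
  by (auto simp: contraction_def sym_def)

lemma irrefl_contraction: "irrefl (contraction R I)"
  by (auto simp: contraction_def irrefl_def)

text \<open>
A cut of \<open>S - I\<close> without an edge of \<open>R\<close> across it forces both sides to touch \<open>I\<close>, and then the
contraction has an edge across it.
\<close>

lemma contraction_connected:
  assumes "sym R" "irrefl R" "induced_connected R S" "I \<subseteq> S" "I \<noteq> S"
  shows "induced_connected (contraction R I) (S - I)"
proof (rule induced_connectedI_crossing)
  show "sym (contraction R I)" by (rule sym_contraction[OF assms(1)])
  show "S - I \<noteq> {}" using assms(4,5) by blast
  fix Z assume Z: "Z \<subseteq> S - I" "Z \<noteq> {}" "Z \<noteq> S - I"
  obtain x y where xy: "x \<in> Z" "y \<in> S - I - Z" using Z by blast
  show "\<exists>a\<in>Z. \<exists>b\<in>S - I - Z. (a, b) \<in> contraction R I"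
  proof (cases "\<exists>a\<in>Z. \<exists>b\<in>S - I - Z. (a, b) \<in> R")
    case True
    then show ?thesis using Z by (force simp: contraction_def)
  next
    case False
    obtain a b where ab: "(a, b) \<in> R" "a \<in> S" "a \<in> Z" "b \<in> S" "b \<notin> Z"
      using induced_connected_crossing[OF assms(3), of x Z y] xy Z by blast
    obtain c d where cd: "(c, d) \<in> R" "c \<in> S" "c \<in> Z \<union> I" "d \<in> S" "d \<notin> Z \<union> I"
      using induced_connected_crossing[OF assms(3), of x "Z \<union> I" y] xy Z by blast
    have "b \<in> I" "c \<in> I" using ab cd False by blast+
    then have "(a, d) \<in> contraction R I"
      using ab cd Z assms(1) by (auto simp: contraction_def sym_def)
    then show ?thesis using ab cd by blast
  qed
qed

section \<open>Families of maximizers and the h-polynomial\<close>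

definition argmax_on :: "('n \<Rightarrow> real) \<Rightarrow> 'n set \<Rightarrow> 'n set" where
  "argmax_on w I = {i \<in> I. \<forall>j\<in>I. w j \<le> w i}"

text \<open>
The maximizers of \<open>w\<close> on the members of the building set of the subgraph induced on \<open>S\<close>. The value
outside the building set is fixed to be empty so that two functionals which define the same face
give equal families.
\<close>

definition max_family :: "'n rel \<Rightarrow> 'n set \<Rightarrow> ('n \<Rightarrow> real) \<Rightarrow> 'n set \<Rightarrow> 'n set" where
  "max_family R S w = (\<lambda>I. if induced_connected R I \<and> I \<subseteq> S then argmax_on w I else {})"

definition max_families :: "'n rel \<Rightarrow> 'n set \<Rightarrow> ('n set \<Rightarrow> 'n set) set" where
  "max_families R S = range (max_family R S)"

text \<open>
The edge directions of the simplex with vertex set \<open>A\<close>; they span the direction space of a face.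
\<close>

definition unit_diffs :: "'n::finite set \<Rightarrow> (real ^ 'n) set" where
  "unit_diffs A = {axis i 1 - axis j 1 |i j. i \<in> A \<and> j \<in> A}"

definition family_dim :: "('n::finite set \<Rightarrow> 'n set) \<Rightarrow> nat" where
  "family_dim \<phi> = dim (\<Union>I. unit_diffs (\<phi> I))"

text \<open>
A family of maximizers is a face of dimension \<open>family_dim\<close>, so this is \<open>f(t - 1)\<close> for the f-polynomial
of the graph-associahedron of the induced subgraph. The functional \<open>0\<close> selects the whole polytope,
whence \<open>rk\<close> below is its dimension.
\<close>

definition hpol :: "('n::finite) rel \<Rightarrow> 'n set \<Rightarrow> int poly" where
  "hpol R S = (\<Sum>\<phi>\<in>max_families R S. [:-1, 1:] ^ family_dim \<phi>)"

definition rk :: "('n::finite) rel \<Rightarrow> 'n set \<Rightarrow> nat" where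
  "rk R S = family_dim (max_family R S (\<lambda>_. 0))"

lemma argmax_on_subset: "argmax_on w I \<subseteq> I"
  by (auto simp: argmax_on_def)

lemma argmax_on_zero [simp]: "argmax_on (\<lambda>_. 0) I = I"
  by (auto simp: argmax_on_def)

lemma argmax_on_nonempty:
  fixes I :: "'n::finite set"
  assumes "I \<noteq> {}"
  shows "argmax_on w I \<noteq> {}"
proof -
  have "Max (w ` I) \<in> w ` I" using assms by (intro Max_in) auto
  then obtain i where "i \<in> I" "w i = Max (w ` I)" by auto
  then have "i \<in> argmax_on w I" by (auto simp: argmax_on_def)
  then show ?thesis by blast
qed

lemma argmax_on_cong: "(\<And>i. i \<in> I \<Longrightarrow> w i = w' i) \<Longrightarrow> argmax_on w I = argmax_on w' I"
  by (auto simp: argmax_on_def)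

lemma argmax_on_Int:
  assumes "J \<subseteq> I" "J \<inter> argmax_on w I \<noteq> {}"
  shows "argmax_on w J = J \<inter> argmax_on w I"
  using assms unfolding argmax_on_def by (auto intro: order_trans)

lemma max_family_subset: "max_family R S w I \<subseteq> I \<inter> S"
  using argmax_on_subset[of w I] by (auto simp: max_family_def)

lemma max_families_subset: "\<phi> \<in> max_families R S \<Longrightarrow> \<phi> I \<subseteq> I \<inter> S"
  using max_family_subset by (force simp: max_families_def)

lemma max_families_eq_empty:
  "\<phi> \<in> max_families R S \<Longrightarrow> \<not> (induced_connected R I \<and> I \<subseteq> S) \<Longrightarrow> \<phi> I = {}"
  unfolding max_families_def max_family_def by (elim rangeE, hypsubst) (rule if_not_P)

lemma max_family_cong:
  assumes "R \<inter> S \<times> S = R' \<inter> S \<times> S"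
  shows "max_family R S = max_family R' S"
proof (intro ext)
  fix w I
  show "max_family R S w I = max_family R' S w I"
    using induced_connected_cong[OF rel_cong_subset[OF assms, of I]]
    by (cases "I \<subseteq> S") (simp_all add: max_family_def)
qed

lemma hpol_cong: "R \<inter> S \<times> S = R' \<inter> S \<times> S \<Longrightarrow> hpol R S = hpol R' S"
  using max_family_cong[of R S R'] by (simp add: hpol_def max_families_def)

lemma rk_cong: "R \<inter> S \<times> S = R' \<inter> S \<times> S \<Longrightarrow> rk R S = rk R' S"
  using max_family_cong[of R S R'] by (simp add: rk_def)

text \<open>
The unit vectors with index in \<open>A\<close> are affinely independent, and the differences span the direction
space of their affine hull.
\<close>

lemma dim_unit_diffs:
  fixes A :: "'n::finite set"
  assumes "A \<noteq> {}"
  shows "dim (unit_diffs A) = card A - 1"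
proof -
  let ?e = "\<lambda>i. axis i (1::real) :: real ^ 'n"
  obtain a where a: "a \<in> A" using assms by blast
  have inj: "inj_on ?e A" by (auto simp: inj_on_def axis_eq_axis)
  have "?e ` A \<subseteq> Basis" by (auto simp: Basis_vec_def)
  then have "independent (?e ` A)" by (rule independent_mono[OF independent_Basis])
  then have "\<not> affine_dependent (?e ` A)" using affine_dependent_imp_dependent by blast
  then have "aff_dim (?e ` A) = int (card A) - 1"
    using aff_dim_affine_independent[of "?e ` A"] card_image[OF inj] by simp
  moreover have "aff_dim (?e ` A) = int (dim ((\<lambda>x. x - ?e a) ` ?e ` A))"
    using a by (intro aff_dim_eq_dim_subtract hull_inc) auto
  moreover have span: "span ((\<lambda>x. x - ?e a) ` ?e ` A) = span (unit_diffs A)"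
  proof (rule span_eq[THEN iffD2], intro conjI subsetI)
    fix x assume "x \<in> (\<lambda>x. x - ?e a) ` ?e ` A"
    then show "x \<in> span (unit_diffs A)" using a by (auto simp: unit_diffs_def intro!: span_base)
  next
    fix x assume "x \<in> unit_diffs A"
    then obtain i j where ij: "i \<in> A" "j \<in> A" "x = (?e i - ?e a) - (?e j - ?e a)"
      by (auto simp: unit_diffs_def)
    show "x \<in> span ((\<lambda>x. x - ?e a) ` ?e ` A)"
      unfolding ij(3) using ij(1,2) by (intro span_diff span_base) auto
  qed
  moreover have "dim ((\<lambda>x. x - ?e a) ` ?e ` A) = dim (unit_diffs A)" by (metis dim_span span)
  ultimately show ?thesis by linarith
qed

lemma unit_diffs_empty [simp]: "unit_diffs {} = {}"
  by (simp add: unit_diffs_def)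

lemma unit_diffs_mono: "A \<subseteq> B \<Longrightarrow> unit_diffs A \<subseteq> unit_diffs B"
  by (auto simp: unit_diffs_def)

lemma unit_diffs_orthogonal:
  assumes "x \<in> unit_diffs A" "y \<in> unit_diffs B" "A \<inter> B = {}"
  shows "x \<bullet> y = 0"
  using assms by (auto simp: unit_diffs_def inner_diff inner_axis_axis)

lemma dim_Un_unit_diffs:
  assumes "X \<subseteq> unit_diffs A" "Y \<subseteq> unit_diffs B" "A \<inter> B = {}"
  shows "dim (X \<union> Y) = dim X + dim Y"
  using assms unit_diffs_orthogonal by (intro dim_orthogonal_sum) blast

lemma family_diffs_subset:
  assumes "\<phi> \<in> max_families R S"
  shows "(\<Union>I. unit_diffs (\<phi> I)) \<subseteq> unit_diffs S"
  using max_families_subset[OF assms] unit_diffs_mono by blast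

lemma max_families_empty: "max_families R {} = {\<lambda>_. {}}"
proof -
  have "max_family R {} w = (\<lambda>_. {})" for w
    by (auto simp: max_family_def fun_eq_iff dest: induced_connected_nonempty)
  then show ?thesis by (auto simp: max_families_def)
qed

lemma family_dim_empty [simp]: "family_dim (\<lambda>_. {}) = 0"
  by (simp add: family_dim_def)

lemma hpol_empty [simp]: "hpol R {} = 1"
  by (simp add: hpol_def max_families_empty)

text \<open>
The family on a connected set \<open>S\<close> whose maximizers on \<open>S\<close> are \<open>S - T\<close> and which restricts to \<open>\<psi>\<close> on
\<open>T\<close>: a connected set that meets \<open>S - T\<close> attains its maximum exactly there.
\<close>

definition extend_family ::
  "'n rel \<Rightarrow> 'n set \<Rightarrow> 'n set \<Rightarrow> ('n set \<Rightarrow> 'n set) \<Rightarrow> 'n set \<Rightarrow> 'n set" where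
  "extend_family R S T \<psi> =
     (\<lambda>I. if induced_connected R I \<and> I \<subseteq> S then if I \<subseteq> T then \<psi> I else I - T else {})"

lemma extend_max_family:
  fixes S :: "'n::finite set"
  assumes "T \<subseteq> S"
  shows "\<exists>w'. extend_family R S T (max_family R T w) = max_family R S w'"
proof -
  \<comment> \<open>a constant above all values of \<open>w\<close>, so that the vertices outside \<open>T\<close> are the maximizers\<close>
  define M where "M = Max (range w) + 1"
  have M: "w i < M" for i
  proof -
    have "w i \<le> Max (range w)" by simp
    then show ?thesis unfolding M_def by linarith
  qed
  define w' where "w' = (\<lambda>i. if i \<in> T then w i else M)"
  have "argmax_on w' I = argmax_on w I" if "I \<subseteq> T" for I
    using that by (intro argmax_on_cong) (auto simp: w'_def)
  moreover have "argmax_on w' I = I - T" if notT: "\<not> I \<subseteq> T" for I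
  proof -
    obtain k where k: "k \<in> I" "k \<notin> T" using notT by blast
    have le: "w' j \<le> M" for j using M[of j] by (simp add: w'_def)
    show ?thesis
    proof (intro equalityI subsetI)
      fix i assume "i \<in> argmax_on w' I"
      then have "i \<in> I" "w' k \<le> w' i" using k by (auto simp: argmax_on_def)
      then show "i \<in> I - T" using M[of i] k by (cases "i \<in> T") (auto simp: w'_def)
    next
      fix i assume "i \<in> I - T"
      then have "i \<in> I" "w' i = M" by (auto simp: w'_def)
      then show "i \<in> argmax_on w' I" using le by (simp add: argmax_on_def)
    qed
  qed
  ultimately have "extend_family R S T (max_family R T w) = max_family R S w'"
    using assms by (intro ext) (simp add: extend_family_def max_family_def)
  then show ?thesis by blast
qed

lemma max_family_extend:
  assumes T: "T = S - argmax_on w S"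
  shows "max_family R S w = extend_family R S T (max_family R T w)"
proof -
  have "argmax_on w I = I - T" if "I \<subseteq> S" "\<not> I \<subseteq> T" for I
  proof -
    have "I \<inter> argmax_on w S \<noteq> {}" using that T by blast
    then have "argmax_on w I = I \<inter> argmax_on w S" by (rule argmax_on_Int[OF that(1)])
    then show ?thesis using T that by blast
  qed
  moreover have "T \<subseteq> S" using T by blast
  ultimately show ?thesis
    by (intro ext) (simp add: extend_family_def max_family_def)
qed

text \<open>
The directions of the extended family are those of \<open>\<psi>\<close>, supported on \<open>T\<close>, and those of the simplex
on \<open>S - T\<close>, which are orthogonal to the former.
\<close>

lemma family_dim_extend:
  fixes S :: "'n::finite set"
  assumes "induced_connected R S" "T \<subset> S" "\<psi> \<in> max_families R T"
  shows "family_dim (extend_family R S T \<psi>) = family_dim \<psi> + (card S - card T - 1)"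
proof -
  let ?\<phi> = "extend_family R S T \<psi>"
  have "(\<Union>I. unit_diffs (?\<phi> I)) = (\<Union>I. unit_diffs (\<psi> I)) \<union> unit_diffs (S - T)"
  proof (intro equalityI subsetI)
    fix x assume "x \<in> (\<Union>I. unit_diffs (?\<phi> I))"
    then obtain I where "x \<in> unit_diffs (?\<phi> I)" by blast
    then show "x \<in> (\<Union>I. unit_diffs (\<psi> I)) \<union> unit_diffs (S - T)"
      using unit_diffs_mono[of "I - T" "S - T"]
      by (auto simp: extend_family_def split: if_splits)
  next
    fix x assume "x \<in> (\<Union>I. unit_diffs (\<psi> I)) \<union> unit_diffs (S - T)"
    then consider I where "x \<in> unit_diffs (\<psi> I)" | "x \<in> unit_diffs (S - T)" by blast
    then show "x \<in> (\<Union>I. unit_diffs (?\<phi> I))"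
    proof cases
      case 1
      then have "\<psi> I \<noteq> {}" by auto
      then have "?\<phi> I = \<psi> I"
        using max_families_eq_empty[OF assms(3), of I] assms(2) by (auto simp: extend_family_def)
      with 1 show ?thesis by (intro UN_I[of I]) simp_all
    next
      case 2
      have "?\<phi> S = S - T" using assms(1,2) by (auto simp: extend_family_def)
      with 2 show ?thesis by (intro UN_I[of S]) simp_all
    qed
  qed
  moreover have "dim ((\<Union>I. unit_diffs (\<psi> I)) \<union> unit_diffs (S - T))
      = dim (\<Union>I. unit_diffs (\<psi> I)) + dim (unit_diffs (S - T))"
    using family_diffs_subset[OF assms(3)]
    by (intro dim_Un_unit_diffs[of _ T _ "S - T"]) auto
  moreover have "dim (unit_diffs (S - T)) = card S - card T - 1"
    using assms(2) by (subst dim_unit_diffs) (auto simp: card_Diff_subset)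
  ultimately show ?thesis by (simp add: family_dim_def)
qed

text \<open>
The recursion that expresses that a family on \<open>S\<close> is a proper subset \<open>T\<close> together with a family on \<open>T\<close>.
\<close>

lemma hpol_connected:
  fixes S :: "'n::finite set"
  assumes "induced_connected R S"
  shows "hpol R S = (\<Sum>T | T \<subset> S. [:-1, 1:] ^ (card S - card T - 1) * hpol R T)"
proof -
  let ?ext = "\<lambda>(T, \<psi>). extend_family R S T \<psi>"
  have bij: "bij_betw ?ext (Sigma {T. T \<subset> S} (max_families R)) (max_families R S)"
    unfolding bij_betw_def
  proof (intro conjI equalityI subsetI)
    show "inj_on ?ext (Sigma {T. T \<subset> S} (max_families R))"
    proof (rule inj_onI)
      fix p q
      assume pq: "p \<in> Sigma {T. T \<subset> S} (max_families R)" "q \<in> Sigma {T. T \<subset> S} (max_families R)"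
        "?ext p = ?ext q"
      define T \<psi> T' \<psi>' where defs: "T = fst p" "\<psi> = snd p" "T' = fst q" "\<psi>' = snd q"
      have *: "T \<subset> S" "\<psi> \<in> max_families R T" "T' \<subset> S" "\<psi>' \<in> max_families R T'"
        and eq: "extend_family R S T \<psi> = extend_family R S T' \<psi>'"
        using pq by (auto simp: defs split: prod.splits)
      from fun_cong[OF eq, of S] have "S - T = S - T'"
        using assms * by (simp add: extend_family_def psubset_eq subset_antisym split: if_splits) 
      then have T: "T = T'" using * by blast
      moreover have "\<psi> I = \<psi>' I" for I
      proof (cases "induced_connected R I \<and> I \<subseteq> T")
        case True
        moreover have "I \<subseteq> S" using True *(1) by blast
        ultimately show ?thesis using fun_cong[OF eq, of I] T by (simp add: extend_family_def)
      next
        case False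
        then show ?thesis using max_families_eq_empty * T by metis
      qed
      ultimately show "p = q" by (simp add: defs prod_eq_iff fun_eq_iff)
    qed
  next
    fix \<phi> assume "\<phi> \<in> ?ext ` Sigma {T. T \<subset> S} (max_families R)"
    then obtain p where p: "p \<in> Sigma {T. T \<subset> S} (max_families R)" "\<phi> = ?ext p"
      by (rule imageE)
    define T where "T = fst p"
    have "T \<subset> S" "snd p \<in> max_families R T" "\<phi> = extend_family R S T (snd p)"
      using p by (auto simp: T_def case_prod_beta)
    moreover from this obtain w where "snd p = max_family R T w" by (auto simp: max_families_def)
    ultimately show "\<phi> \<in> max_families R S"
      using extend_max_family[of T S R w] by (auto simp: max_families_def)
  next
    fix \<phi> assume "\<phi> \<in> max_families R S"
    then obtain w where w: "\<phi> = max_family R S w" by (auto simp: max_families_def)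
    define T where "T = S - argmax_on w S"
    have "T \<subset> S"
      using argmax_on_nonempty[OF induced_connected_nonempty[OF assms], of w] argmax_on_subset[of w S]
      by (auto simp: T_def)
    moreover have "\<phi> = ?ext (T, max_family R T w)"
      using max_family_extend[OF T_def] w by simp
    ultimately show "\<phi> \<in> ?ext ` Sigma {T. T \<subset> S} (max_families R)"
      by (intro image_eqI[of _ _ "(T, max_family R T w)"]) (auto simp: max_families_def)
  qed
  have "hpol R S = (\<Sum>p\<in>Sigma {T. T \<subset> S} (max_families R). [:-1, 1:] ^ family_dim (?ext p))"
    unfolding hpol_def by (rule sum.reindex_bij_betw[OF bij, symmetric])
  also have "\<dots> = (\<Sum>(T, \<psi>)\<in>Sigma {T. T \<subset> S} (max_families R).
      [:-1, 1:] ^ (card S - card T - 1) * [:-1, 1:] ^ family_dim \<psi>)"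
  proof (rule sum.cong[OF refl])
    fix p assume "p \<in> Sigma {T. T \<subset> S} (max_families R)"
    then have "fst p \<subset> S" "snd p \<in> max_families R (fst p)" by auto
    then show "[:-1, 1:] ^ family_dim (?ext p) = (case p of (T, \<psi>) \<Rightarrow>
        [:-1, 1:] ^ (card S - card T - 1) * [:-1, 1:] ^ family_dim \<psi>)"
      using family_dim_extend[OF assms, of "fst p" "snd p"]
      by (simp add: case_prod_beta power_add mult.commute)
  qed
  also have "\<dots> = (\<Sum>T | T \<subset> S. [:-1, 1:] ^ (card S - card T - 1) * hpol R T)"
    unfolding hpol_def sum_distrib_left by (rule sum.Sigma[symmetric]) auto
  finally show ?thesis .
qed

lemma rk_connected:
  fixes S :: "'n::finite set"
  assumes "induced_connected R S"
  shows "rk R S = card S - 1"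
proof -
  have "max_family R S (\<lambda>_. 0) = extend_family R S {} (max_family R {} (\<lambda>_. 0))"
    by (rule max_family_extend) simp
  moreover have "max_family R {} (\<lambda>_. 0) \<in> max_families R {}" by (simp add: max_families_def)
  moreover have "{} \<subset> S" using induced_connected_nonempty[OF assms] by blast
  ultimately show ?thesis
    using family_dim_extend[OF assms, of "{}"] by (simp add: rk_def max_families_empty)
qed

text \<open>A connected subset of a separated union lies on one side, so families combine freely.\<close>

lemma max_family_Un:
  assumes "separated R A B" "sym R"
    and "\<And>i. i \<in> A \<Longrightarrow> w i = w1 i" "\<And>i. i \<in> B \<Longrightarrow> w i = w2 i"
  shows "max_family R (A \<union> B) w = (\<lambda>I. max_family R A w1 I \<union> max_family R B w2 I)"
proof
  fix I
  have disj: "A \<inter> B = {}" using assms(1) by (simp add: separated_def)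
  show "max_family R (A \<union> B) w I = max_family R A w1 I \<union> max_family R B w2 I"
  proof (cases "induced_connected R I \<and> I \<subseteq> A \<union> B")
    case True
    then have ne: "I \<noteq> {}" using induced_connected_nonempty by blast
    then obtain x where "x \<in> I" by blast
    then have "I \<subseteq> A \<or> I \<subseteq> B"
      using True connected_in_separated[OF assms(1), of I x]
        connected_in_separated[OF separated_sym[OF assms(2,1)], of I x] by (auto simp: Un_commute)
    then consider "I \<subseteq> A" | "I \<subseteq> B" by blast
    then show ?thesis
    proof cases
      case 1
      then have "argmax_on w I = argmax_on w1 I" using assms(3) by (intro argmax_on_cong) blast
      moreover have "\<not> I \<subseteq> B" using 1 ne disj by blast
      ultimately show ?thesis using True 1 by (simp add: max_family_def)
    next
      case 2
      then have "argmax_on w I = argmax_on w2 I" using assms(4) by (intro argmax_on_cong) blast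
      moreover have "\<not> I \<subseteq> A" using 2 ne disj by blast
      ultimately show ?thesis using True 2 by (simp add: max_family_def)
    qed
  next
    case False
    then have "\<not> (induced_connected R I \<and> I \<subseteq> A)" "\<not> (induced_connected R I \<and> I \<subseteq> B)" by blast+
    then show ?thesis using False unfolding max_family_def by (simp only: if_False Un_empty_left)
  qed
qed

text \<open>
No connected set is contained in both parts, so the directions split into two orthogonal sets.
\<close>

lemma family_dim_Un:
  assumes "\<phi> \<in> max_families R A" "\<psi> \<in> max_families R B" "separated R A B"
  shows "family_dim (\<lambda>I. \<phi> I \<union> \<psi> I) = family_dim \<phi> + family_dim \<psi>"
proof -
  have "\<phi> I = {} \<or> \<psi> I = {}" for I
  proof (rule ccontr)
    assume "\<not> ?thesis"
    then have "induced_connected R I" "I \<subseteq> A" "I \<subseteq> B"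
      using max_families_eq_empty assms(1,2) by metis+
    then show False using assms(3) induced_connected_nonempty by (fastforce simp: separated_def)
  qed
  then have *: "unit_diffs (\<phi> I \<union> \<psi> I) = unit_diffs (\<phi> I) \<union> unit_diffs (\<psi> I)" for I
    by (metis sup_bot_left sup_bot_right unit_diffs_empty)
  have "(\<Union>I. unit_diffs (\<phi> I \<union> \<psi> I)) = (\<Union>I. unit_diffs (\<phi> I)) \<union> (\<Union>I. unit_diffs (\<psi> I))"
    by (simp only: * UN_Un_distrib)
  moreover have "dim ((\<Union>I. unit_diffs (\<phi> I)) \<union> (\<Union>I. unit_diffs (\<psi> I)))
      = dim (\<Union>I. unit_diffs (\<phi> I)) + dim (\<Union>I. unit_diffs (\<psi> I))"
    using family_diffs_subset[OF assms(1)] family_diffs_subset[OF assms(2)] assms(3)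
    by (intro dim_Un_unit_diffs) (auto simp: separated_def)
  ultimately show ?thesis by (simp add: family_dim_def)
qed

lemma hpol_Un:
  fixes A :: "'n::finite set"
  assumes "sym R" "separated R A B"
  shows "hpol R (A \<union> B) = hpol R A * hpol R B"
proof -
  let ?un = "\<lambda>(\<phi>, \<psi>) I. \<phi> I \<union> \<psi> I"
  have disj: "A \<inter> B = {}" using assms(2) by (simp add: separated_def)
  have bij: "bij_betw ?un (max_families R A \<times> max_families R B) (max_families R (A \<union> B))"
    unfolding bij_betw_def
  proof (intro conjI equalityI subsetI)
    show "inj_on ?un (max_families R A \<times> max_families R B)"
    proof (rule inj_onI, clarify)
      fix \<phi> \<psi> \<phi>' \<psi>'
      assume *: "\<phi> \<in> max_families R A" "\<psi> \<in> max_families R B"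
        "\<phi>' \<in> max_families R A" "\<psi>' \<in> max_families R B"
        and eq: "(\<lambda>I. \<phi> I \<union> \<psi> I) = (\<lambda>I. \<phi>' I \<union> \<psi>' I)"
      have "\<phi> I = (\<phi> I \<union> \<psi> I) \<inter> A" "\<psi> I = (\<phi> I \<union> \<psi> I) \<inter> B"
        "\<phi>' I = (\<phi>' I \<union> \<psi>' I) \<inter> A" "\<psi>' I = (\<phi>' I \<union> \<psi>' I) \<inter> B" for I
        using max_families_subset[OF *(1), of I] max_families_subset[OF *(2), of I]
          max_families_subset[OF *(3), of I] max_families_subset[OF *(4), of I] disj by blast+
      then show "\<phi> = \<phi>' \<and> \<psi> = \<psi>'" using fun_cong[OF eq] by (metis ext)
    qed
  next
    fix \<phi> assume "\<phi> \<in> ?un ` (max_families R A \<times> max_families R B)"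
    then obtain w1 w2 where "\<phi> = (\<lambda>I. max_family R A w1 I \<union> max_family R B w2 I)"
      by (auto simp: max_families_def)
    also have "\<dots> = max_family R (A \<union> B) (\<lambda>i. if i \<in> A then w1 i else w2 i)"
      using disj by (intro max_family_Un[OF assms(2,1), symmetric]) auto
    finally show "\<phi> \<in> max_families R (A \<union> B)" by (simp add: max_families_def)
  next
    fix \<phi> assume "\<phi> \<in> max_families R (A \<union> B)"
    then obtain w where "\<phi> = max_family R (A \<union> B) w" by (auto simp: max_families_def)
    also have "\<dots> = ?un (max_family R A w, max_family R B w)"
      using max_family_Un[OF assms(2,1), of w w w] by simp
    finally show "\<phi> \<in> ?un ` (max_families R A \<times> max_families R B)"
      by (auto simp: max_families_def)
  qed
  have "hpol R (A \<union> B) = (\<Sum>p\<in>max_families R A \<times> max_families R B. [:-1, 1:] ^ family_dim (?un p))"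
    unfolding hpol_def by (rule sum.reindex_bij_betw[OF bij, symmetric])
  also have "\<dots> = (\<Sum>(\<phi>, \<psi>)\<in>max_families R A \<times> max_families R B.
      [:-1, 1:] ^ family_dim \<phi> * [:-1, 1:] ^ family_dim \<psi>)"
    using family_dim_Un[OF _ _ assms(2)] by (intro sum.cong) (auto simp: power_add)
  also have "\<dots> = hpol R A * hpol R B"
    unfolding hpol_def sum_product by (rule sum.cartesian_product[symmetric])
  finally show ?thesis .
qed

lemma rk_Un:
  assumes "sym R" "separated R A B"
  shows "rk R (A \<union> B) = rk R A + rk R B"
proof -
  have "max_family R (A \<union> B) (\<lambda>_. 0)
      = (\<lambda>I. max_family R A (\<lambda>_. 0) I \<union> max_family R B (\<lambda>_. 0) I)"
    by (rule max_family_Un[OF assms(2,1)]) auto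
  then show ?thesis
    unfolding rk_def by (simp add: family_dim_Un[OF _ _ assms(2)] max_families_def)
qed

lemma no_edges_hpol_rk:
  fixes S :: "'n::finite set"
  assumes "R \<inter> S \<times> S = {}"
  shows "hpol R S = 1" "rk R S = 0"
proof -
  have sing: "\<exists>i. I = {i}" if I: "induced_connected R I" "I \<subseteq> S" for I
  proof -
    obtain i where i: "i \<in> I" using I(1) induced_connected_nonempty by blast
    have "j = i" if "j \<in> I" for j
      using induced_connected_crossing[OF I(1) i, of "{i}" j] that assms I(2)
      by blast
    then show ?thesis using i by blast
  qed
  have "argmax_on w {i} = {i}" for w and i :: 'n by (auto simp: argmax_on_def)
  then have "argmax_on w I = I" if "induced_connected R I" "I \<subseteq> S" for I w
    using sing[OF that] by metis
  then have *: "max_family R S w = (\<lambda>I. if induced_connected R I \<and> I \<subseteq> S then I else {})" for w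
    by (auto simp: max_family_def fun_eq_iff)
  have "(\<Union>I. unit_diffs (max_family R S w I)) \<subseteq> {0}" for w
  proof (rule UN_least)
    fix I show "unit_diffs (max_family R S w I) \<subseteq> {0}"
      unfolding * using sing[of I] by (auto simp: unit_diffs_def)
  qed
  then have dim0: "family_dim (max_family R S w) = 0" for w
    by (simp add: family_dim_def)
  have "max_families R S = {max_family R S (\<lambda>_. 0)}"
    unfolding max_families_def * by auto
  then show "hpol R S = 1" by (simp add: hpol_def dim0)
  show "rk R S = 0" by (simp add: rk_def dim0)
qed

section \<open>Adding an edge\<close>

definition add_edge :: "'n rel \<Rightarrow> 'n \<Rightarrow> 'n \<Rightarrow> 'n rel" where
  "add_edge R u v = R \<union> {(u, v), (v, u)}"

text \<open>
The unions \<open>C \<union> D\<close> are the connected sets of \<open>add_edge R u v\<close> in which \<open>u v\<close> is a bridge; the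
summands of the edge formula refer to the two sides of that bridge.
\<close>

definition edge_pairs :: "'n rel \<Rightarrow> 'n \<Rightarrow> 'n \<Rightarrow> 'n set \<Rightarrow> ('n set \<times> 'n set) set" where
  "edge_pairs R u v S = {(C, D). C \<subseteq> S \<and> D \<subseteq> S \<and> u \<in> C \<and> v \<in> D \<and>
     induced_connected R C \<and> induced_connected R D \<and> separated R C D}"

lemma sym_add_edge: "sym R \<Longrightarrow> sym (add_edge R u v)"
  by (auto simp: add_edge_def sym_def)

lemma irrefl_add_edge: "irrefl R \<Longrightarrow> u \<noteq> v \<Longrightarrow> irrefl (add_edge R u v)"
  by (auto simp: add_edge_def irrefl_def)

lemma add_edge_outside: "u \<notin> S \<or> v \<notin> S \<Longrightarrow> add_edge R u v \<inter> S \<times> S = R \<inter> S \<times> S"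
  by (auto simp: add_edge_def)

lemma edge_pairs_outside: "u \<notin> S \<or> v \<notin> S \<Longrightarrow> edge_pairs R u v S = {}"
  by (auto simp: edge_pairs_def)

lemma edge_pairs_separated_union:
  assumes "sym R" "separated R A B" "u \<in> A" "v \<in> A"
  shows "edge_pairs R u v (A \<union> B) = edge_pairs R u v A"
  using connected_in_separated[OF assms(2) _ _ _ assms(3)]
    connected_in_separated[OF assms(2) _ _ _ assms(4)]
  by (auto simp: edge_pairs_def)

lemma edge_pairs_subset:
  assumes "T \<subseteq> S"
  shows "edge_pairs R u v T = {p \<in> edge_pairs R u v S. fst p \<union> snd p \<subseteq> T}"
  using assms by (auto simp: edge_pairs_def)

lemma contraction_separated:
  assumes "sym R" "separated R A B" "I \<subseteq> A"
  shows "separated (contraction R I) (A - I) B"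
    and "irrefl R \<Longrightarrow> contraction R I \<inter> B \<times> B = R \<inter> B \<times> B"
proof -
  have B: "y \<notin> R `` I" "y \<notin> I" if "y \<in> B" for y
    using that assms by (auto simp: separated_def)
  then show "separated (contraction R I) (A - I) B"
    using assms by (auto simp: separated_def contraction_def)
  show "contraction R I \<inter> B \<times> B = R \<inter> B \<times> B" if "irrefl R"
    using B that by (auto simp: contraction_def irrefl_def)
qed

text \<open>
If only the new edge makes \<open>S\<close> connected, then \<open>S\<close> has exactly two components without it, one for each
end of the edge, and every connected set lies in one of them.
\<close>

lemma bridge_pair:
  assumes "sym R" "u \<in> S" "v \<in> S" "induced_connected (add_edge R u v) S" "\<not> induced_connected R S"
  obtains C D where "S = C \<union> D" "{p \<in> edge_pairs R u v S. fst p \<union> snd p = S} = {(C, D)}"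
proof -
  let ?R' = "add_edge R u v"
  obtain C where C: "u \<in> C" "C \<subseteq> S" "induced_connected R C" "separated R C (S - C)"
    using component_exists[OF assms(1,2)] by metis
  have "C \<noteq> S" using C(3) assms(5) by auto
  then obtain y where y: "y \<in> S - C" using C(2) by blast
  have v: "v \<in> S - C"
  proof (rule ccontr)
    assume "v \<notin> S - C"
    then have vC: "v \<in> C" using assms(3) by blast
    obtain a b where "(a, b) \<in> ?R'" "a \<in> C" "b \<in> S" "b \<notin> C"
      using induced_connected_crossing[OF assms(4), of u C y] C y assms(2) by auto
    then show False using C vC by (auto simp: add_edge_def separated_def)
  qed
  obtain D where D: "v \<in> D" "D \<subseteq> S - C" "induced_connected R D" "separated R D (S - C - D)"
    using component_exists[OF assms(1) v] by metis
  have S: "S = C \<union> D"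
  proof (rule ccontr)
    assume "S \<noteq> C \<union> D"
    moreover have "C \<union> D \<subseteq> S" using C(2) D(2) by blast
    ultimately obtain z where z: "z \<in> S" "z \<notin> C \<union> D" by blast
    obtain a b where "(a, b) \<in> ?R'" "a \<in> C \<union> D" "b \<in> S" "b \<notin> C \<union> D"
      using induced_connected_crossing[OF assms(4), of u "C \<union> D" z] C z assms(2) by auto
    then show False using C D by (auto simp: add_edge_def separated_def)
  qed
  have sep: "separated R C D" by (rule separated_mono[OF C(4) order_refl D(2)])
  have "(C, D) \<in> edge_pairs R u v S" using C D sep by (auto simp: edge_pairs_def)
  moreover have "C' = C \<and> D' = D"
    if CD': "(C', D') \<in> edge_pairs R u v S" "C' \<union> D' = S" for C' D'
  proof -
    have "C' \<subseteq> C"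
      using connected_in_separated[OF sep, of C' u] CD' C S by (auto simp: edge_pairs_def)
    moreover have "D' \<subseteq> D"
      using connected_in_separated[OF separated_sym[OF assms(1) sep], of D' v] CD' D S
      by (auto simp: edge_pairs_def)
    ultimately show ?thesis using CD'(2) S sep by (auto simp: separated_def)
  qed
  ultimately have "p \<in> edge_pairs R u v S \<and> fst p \<union> snd p = S \<longleftrightarrow> p = (C, D)" for p
    by (cases p) (metis S fst_conv snd_conv)
  then have "{p \<in> edge_pairs R u v S. fst p \<union> snd p = S} = {(C, D)}" by simp
  with S show thesis using that by blast
qed

lemma no_exhausting_pair:
  assumes "induced_connected R S" "p \<in> edge_pairs R u v S"
  shows "fst p \<union> snd p \<noteq> S"
proof
  obtain C D where p: "p = (C, D)" by (cases p)
  assume "fst p \<union> snd p = S"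
  then have S: "S = C \<union> D" and CD: "u \<in> C" "v \<in> D" "separated R C D"
    using assms(2) p by (auto simp: edge_pairs_def)
  then have "v \<notin> C" by (auto simp: separated_def)
  then obtain a b where "(a, b) \<in> R" "a \<in> C" "b \<in> S" "b \<notin> C"
    using induced_connected_crossing[OF assms(1), of u C v] S CD by auto
  then show False using S CD by (auto simp: separated_def)
qed

lemma card_edge_pair:
  fixes S :: "'n::finite set"
  assumes "(C, D) \<in> edge_pairs R u v S"
  shows "card (C \<union> D) = card C + card D"
  using assms by (intro card_Un_disjoint) (auto simp: edge_pairs_def separated_def)

lemma sum_Pow_Un:
  fixes f :: "'a set \<Rightarrow> 'b::comm_semiring_1"
  assumes "A \<inter> B = {}" "\<And>T U. T \<subseteq> A \<Longrightarrow> U \<subseteq> B \<Longrightarrow> f (T \<union> U) = g T * h U"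
  shows "(\<Sum>T\<in>Pow (A \<union> B). f T) = (\<Sum>T\<in>Pow A. g T) * (\<Sum>U\<in>Pow B. h U)"
proof -
  have bij: "bij_betw (\<lambda>(T, U). T \<union> U) (Pow A \<times> Pow B) (Pow (A \<union> B))"
    using assms(1)
    by (intro bij_betw_byWitness[where f' = "\<lambda>T. (T \<inter> A, T \<inter> B)"]) auto
  have "(\<Sum>T\<in>Pow (A \<union> B). f T) = (\<Sum>p\<in>Pow A \<times> Pow B. f (fst p \<union> snd p))"
    using sum.reindex_bij_betw[OF bij, of f] by (simp add: case_prod_beta)
  also have "\<dots> = (\<Sum>(T, U)\<in>Pow A \<times> Pow B. g T * h U)"
    using assms(2) by (intro sum.cong) auto
  also have "\<dots> = (\<Sum>T\<in>Pow A. g T) * (\<Sum>U\<in>Pow B. h U)"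
    by (simp add: sum_product sum.cartesian_product)
  finally show ?thesis .
qed

lemma sum_Pow_hpol:
  fixes S :: "'n::finite set"
  shows "(\<Sum>T\<in>Pow S. [:-1, 1:] ^ (card S - card T) * hpol R T)
    = [:-1, 1:] * (\<Sum>T | T \<subset> S. [:-1, 1:] ^ (card S - card T - 1) * hpol R T) + hpol R S"
proof -
  have Pow: "Pow S = insert S {T. T \<subset> S}" by auto
  have "[:-1, 1 :: int:] ^ (card S - card T) = [:-1, 1:] * [:-1, 1:] ^ (card S - card T - 1)"
    if "T \<subset> S" for T
  proof -
    have "card T < card S" using that by (intro psubset_card_mono) auto
    then have "card S - card T = Suc (card S - card T - 1)" by linarith
    then show ?thesis by (metis power_Suc)
  qed
  then have "(\<Sum>T | T \<subset> S. [:-1, 1:] ^ (card S - card T) * hpol R T)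
      = [:-1, 1:] * (\<Sum>T | T \<subset> S. [:-1, 1:] ^ (card S - card T - 1) * hpol R T)"
    unfolding sum_distrib_left mult.assoc[symmetric] by (intro sum.cong) (simp_all only: mem_Collect_eq)
  then show ?thesis unfolding Pow by (subst sum.insert) auto
qed

text \<open>
Adding the summand \<open>T = S\<close> to \<open>t - 1\<close> times the sum of the recursion gives a sum over all subsets. That
sum is multiplicative over separated unions and equals \<open>t * h\<close> on a connected set, so on \<open>C \<union> D\<close> it
is \<open>t\<^sup>2 * h(C) * h(D)\<close>; and \<open>t\<^sup>2 - 1 = (t - 1) * (t + 1)\<close>.
\<close>

lemma sum_proper_subsets_separated:
  fixes C :: "'n::finite set"
  assumes "sym R" "separated R C D" "induced_connected R C" "induced_connected R D"
  shows "(\<Sum>T | T \<subset> C \<union> D. [:-1, 1:] ^ (card (C \<union> D) - card T - 1) * hpol R T)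
    = hpol R C * hpol R D + [:0, 1:] * (hpol R C * hpol R D)" (is "?A = _")
proof -
  let ?Y = "[:-1, 1:] :: int poly"
  define W where "W S = (\<Sum>T\<in>Pow S. ?Y ^ (card S - card T) * hpol R T)" for S
  have disj: "C \<inter> D = {}" using assms(2) by (simp add: separated_def)
  have W_conn: "W S = [:0, 1:] * hpol R S" if "induced_connected R S" for S
    unfolding W_def sum_Pow_hpol hpol_connected[OF that, symmetric] by simp
  have "W (C \<union> D) = W C * W D"
    unfolding W_def
  proof (rule sum_Pow_Un[OF disj])
    fix T U assume TU: "T \<subseteq> C" "U \<subseteq> D"
    have "card (C \<union> D) - card (T \<union> U) = (card C - card T) + (card D - card U)"
      using TU disj card_mono[OF _ TU(1)] card_mono[OF _ TU(2)]
      by (subst card_Un_disjoint, simp, simp, simp, subst card_Un_disjoint) auto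
    moreover have "hpol R (T \<union> U) = hpol R T * hpol R U"
      using assms(1) separated_mono[OF assms(2) TU] by (rule hpol_Un)
    ultimately show "?Y ^ (card (C \<union> D) - card (T \<union> U)) * hpol R (T \<union> U)
        = ?Y ^ (card C - card T) * hpol R T * (?Y ^ (card D - card U) * hpol R U)"
      by (simp add: power_add mult_ac)
  qed
  then have "?Y * ?A + hpol R C * hpol R D = [:0, 1:] * hpol R C * ([:0, 1:] * hpol R D)"
    using W_conn assms(3,4) hpol_Un[OF assms(1,2)] unfolding W_def sum_Pow_hpol by simp
  then have "?Y * ?A = ?Y * (hpol R C * hpol R D + [:0, 1:] * (hpol R C * hpol R D))"
    by (simp add: algebra_simps)
  then show ?thesis by (rule mult_left_cancel[THEN iffD1, rotated]) simp
qed

definition edge_term :: "('n::finite) rel \<Rightarrow> 'n \<Rightarrow> 'n \<Rightarrow> 'n set \<Rightarrow> 'n set \<times> 'n set \<Rightarrow> int poly" where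
  "edge_term R u v S = (\<lambda>(C, D). hpol R C * hpol R D *
     hpol (contraction (add_edge R u v) (C \<union> D)) (S - (C \<union> D)))"

text \<open>
Exchanging the two summations, the sets \<open>T\<close> between \<open>C \<union> D\<close> and \<open>S\<close> give the recursion for the
contraction by \<open>C \<union> D\<close>, which is connected because \<open>S\<close> is. The pairs that exhaust \<open>S\<close> never fit into a
proper subset \<open>T\<close>.
\<close>

lemma sum_edge_terms:
  fixes S :: "'n::finite set"
  assumes "sym R" "irrefl R" "u \<noteq> v" "induced_connected (add_edge R u v) S"
  shows "(\<Sum>T | T \<subset> S. [:-1, 1:] ^ (card S - card T - 1) * (\<Sum>p\<in>edge_pairs R u v T. edge_term R u v T p))
    = (\<Sum>p\<in>{p \<in> edge_pairs R u v S. fst p \<union> snd p \<noteq> S}. edge_term R u v S p)"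
proof -
  let ?Y = "[:-1, 1:] :: int poly"
  let ?P = "{p \<in> edge_pairs R u v S. fst p \<union> snd p \<noteq> S}"
  have "(\<Sum>T | T \<subset> S. ?Y ^ (card S - card T - 1) * (\<Sum>p\<in>edge_pairs R u v T. edge_term R u v T p))
      = (\<Sum>T | T \<subset> S. \<Sum>p\<in>{p \<in> ?P. fst p \<union> snd p \<subseteq> T}. ?Y ^ (card S - card T - 1) * edge_term R u v T p)"
  proof (rule sum.cong[OF refl])
    fix T assume T: "T \<in> {T. T \<subset> S}"
    then have "edge_pairs R u v T = {p \<in> ?P. fst p \<union> snd p \<subseteq> T}"
      using edge_pairs_subset[of T S R u v] by auto
    then show "?Y ^ (card S - card T - 1) * (\<Sum>p\<in>edge_pairs R u v T. edge_term R u v T p)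
      = (\<Sum>p\<in>{p \<in> ?P. fst p \<union> snd p \<subseteq> T}. ?Y ^ (card S - card T - 1) * edge_term R u v T p)"
      by (simp add: sum_distrib_left)
  qed
  also have "\<dots> = (\<Sum>p\<in>?P. \<Sum>T\<in>{T \<in> {T. T \<subset> S}. fst p \<union> snd p \<subseteq> T}.
      ?Y ^ (card S - card T - 1) * edge_term R u v T p)"
    by (rule sum.swap_restrict) auto
  also have "\<dots> = (\<Sum>p\<in>?P. edge_term R u v S p)"
  proof (rule sum.cong[OF refl])
    fix p assume p: "p \<in> ?P"
    obtain C D where CD: "p = (C, D)" by (cases p)
    define I where "I = C \<union> D"
    have I: "I \<subseteq> S" "I \<noteq> S" using p CD by (auto simp: edge_pairs_def I_def)
    let ?K = "contraction (add_edge R u v) I"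
    have conn: "induced_connected ?K (S - I)"
      using sym_add_edge[OF assms(1)] irrefl_add_edge[OF assms(2,3)] assms(4) I
      by (rule contraction_connected)
    have bij: "bij_betw (\<lambda>U. U \<union> I) {U. U \<subset> S - I} {T \<in> {T. T \<subset> S}. I \<subseteq> T}"
      using I by (intro bij_betw_byWitness[where f' = "\<lambda>T. T - I"]) auto
    have "(\<Sum>T\<in>{T \<in> {T. T \<subset> S}. I \<subseteq> T}. ?Y ^ (card S - card T - 1) * hpol ?K (T - I))
        = (\<Sum>U | U \<subset> S - I. ?Y ^ (card S - card (U \<union> I) - 1) * hpol ?K (U \<union> I - I))"
      by (rule sum.reindex_bij_betw[OF bij, symmetric])
    also have "\<dots> = (\<Sum>U | U \<subset> S - I. ?Y ^ (card (S - I) - card U - 1) * hpol ?K U)"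
    proof (rule sum.cong[OF refl])
      fix U assume "U \<in> {U. U \<subset> S - I}"
      then have U: "U \<inter> I = {}" by blast
      then have "card (U \<union> I) = card U + card I" by (intro card_Un_disjoint) auto
      moreover have "card (S - I) = card S - card I" using I by (intro card_Diff_subset) auto
      moreover have "U \<union> I - I = U" using U by blast
      ultimately show "?Y ^ (card S - card (U \<union> I) - 1) * hpol ?K (U \<union> I - I)
          = ?Y ^ (card (S - I) - card U - 1) * hpol ?K U"
        by (simp add: add.commute)
    qed
    also have "\<dots> = hpol ?K (S - I)" by (rule hpol_connected[OF conn, symmetric])
    finally have inner: "(\<Sum>T\<in>{T \<in> {T. T \<subset> S}. I \<subseteq> T}. ?Y ^ (card S - card T - 1) * hpol ?K (T - I))
        = hpol ?K (S - I)" .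
    have "(\<Sum>T\<in>{T \<in> {T. T \<subset> S}. fst p \<union> snd p \<subseteq> T}. ?Y ^ (card S - card T - 1) * edge_term R u v T p)
        = (\<Sum>T\<in>{T \<in> {T. T \<subset> S}. I \<subseteq> T}.
            hpol R C * hpol R D * (?Y ^ (card S - card T - 1) * hpol ?K (T - I)))"
      by (simp only: CD I_def edge_term_def fst_conv snd_conv prod.case mult_ac)
    also have "\<dots> = hpol R C * hpol R D * hpol ?K (S - I)"
      by (simp only: sum_distrib_left[symmetric] inner)
    also have "\<dots> = edge_term R u v S p"
      by (simp only: CD I_def edge_term_def prod.case)
    finally show "(\<Sum>T\<in>{T \<in> {T. T \<subset> S}. fst p \<union> snd p \<subseteq> T}.
        ?Y ^ (card S - card T - 1) * edge_term R u v T p) = edge_term R u v S p" .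
  qed
  finally show ?thesis .
qed

text \<open>
Induction on the size of \<open>S\<close>. The case of a disconnected set reduces to the component of the new
edge. For a connected set the formula is applied to each proper subset in the recursion; what
remains is the sum of the recursion for \<open>R\<close> itself, which is \<open>h(R, S)\<close> if \<open>S\<close> is connected in \<open>R\<close>,
and otherwise differs from it by the summand of the unique pair that exhausts \<open>S\<close>.
\<close>

theorem hpol_add_edge:
  fixes S :: "'n::finite set"
  assumes "sym R" "irrefl R" "u \<noteq> v"
  shows "hpol (add_edge R u v) S
    = hpol R S + [:0, 1:] * (\<Sum>p\<in>edge_pairs R u v S. edge_term R u v S p)"
proof (induction "card S" arbitrary: S rule: less_induct)
  case less
  let ?R' = "add_edge R u v" and ?Y = "[:-1, 1:] :: int poly"
  note sym' = sym_add_edge[OF assms(1), of u v]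
  note irrefl' = irrefl_add_edge[OF assms(2,3)]
  consider "u \<notin> S \<or> v \<notin> S" | "u \<in> S" "v \<in> S" "\<not> induced_connected ?R' S"
    | "u \<in> S" "v \<in> S" "induced_connected ?R' S" by blast
  then show ?case
  proof cases
    case 1
    then show ?thesis
      using hpol_cong[OF add_edge_outside[OF 1, of R]] by (simp add: edge_pairs_outside)
  next
    case 2
    obtain A where A: "u \<in> A" "A \<subseteq> S" "induced_connected ?R' A" "separated ?R' A (S - A)"
      using component_exists[OF sym' 2(1)] by metis
    define B where "B = S - A"
    have v: "v \<in> A" using A 2 by (auto simp: separated_def add_edge_def)
    have S: "S = A \<union> B" using A by (auto simp: B_def)
    have AS: "card A < card S" using A 2(3) by (intro psubset_card_mono) auto
    have sepR': "separated ?R' A B" using A by (simp add: B_def)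
    then have sep: "separated R A B" by (auto simp: separated_def add_edge_def)
    have B: "?R' \<inter> B \<times> B = R \<inter> B \<times> B"
      using A by (intro add_edge_outside) (simp add: B_def)
    have pair_term: "edge_term R u v S p = edge_term R u v A p * hpol R B" if "p \<in> edge_pairs R u v A" for p
    proof -
      obtain C D where CD: "p = (C, D)" by (cases p)
      define I where "I = C \<union> D"
      have I: "I \<subseteq> A" using that CD by (auto simp: edge_pairs_def I_def)
      have "S - I = (A - I) \<union> B" using I S sep by (auto simp: separated_def)
      then have "hpol (contraction ?R' I) (S - I)
          = hpol (contraction ?R' I) (A - I) * hpol (contraction ?R' I) B"
        using hpol_Un[OF sym_contraction[OF sym'] contraction_separated(1)[OF sym' sepR' I]] by simp
      also have "hpol (contraction ?R' I) B = hpol R B"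
        using contraction_separated(2)[OF sym' sepR' I irrefl'] B by (intro hpol_cong) simp
      finally show ?thesis by (simp add: edge_term_def CD I_def)
    qed
    have "hpol ?R' S = hpol ?R' A * hpol R B"
      using hpol_Un[OF sym' sepR'] hpol_cong[OF B] S by simp
    also have "hpol ?R' A = hpol R A + [:0, 1:] * (\<Sum>p\<in>edge_pairs R u v A. edge_term R u v A p)"
      by (rule less[OF AS])
    also have "(hpol R A + [:0, 1:] * (\<Sum>p\<in>edge_pairs R u v A. edge_term R u v A p)) * hpol R B
        = hpol R A * hpol R B + [:0, 1:] * (\<Sum>p\<in>edge_pairs R u v A. edge_term R u v A p * hpol R B)"
      by (simp only: distrib_right sum_distrib_right mult.assoc)
    also have "(\<Sum>p\<in>edge_pairs R u v A. edge_term R u v A p * hpol R B)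
        = (\<Sum>p\<in>edge_pairs R u v S. edge_term R u v S p)"
      using edge_pairs_separated_union[OF assms(1) sep A(1) v] S pair_term by (intro sum.cong) auto
    also have "hpol R A * hpol R B = hpol R S"
      using hpol_Un[OF assms(1) sep] S by simp
    finally show ?thesis .
  next
    case 3
    let ?P = "{p \<in> edge_pairs R u v S. fst p \<union> snd p \<noteq> S}"
    let ?Q = "{p \<in> edge_pairs R u v S. fst p \<union> snd p = S}"
    let ?a = "\<lambda>T. ?Y ^ (card S - card T - 1)"
    have "hpol ?R' S = (\<Sum>T | T \<subset> S. ?a T * hpol ?R' T)" by (rule hpol_connected[OF 3(3)])
    also have "\<dots> = (\<Sum>T | T \<subset> S. ?a T * hpol R T
        + [:0, 1:] * (?a T * (\<Sum>p\<in>edge_pairs R u v T. edge_term R u v T p)))"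
    proof (rule sum.cong[OF refl])
      fix T assume "T \<in> {T. T \<subset> S}"
      then have "card T < card S" by (intro psubset_card_mono) auto
      then show "?a T * hpol ?R' T = ?a T * hpol R T
          + [:0, 1:] * (?a T * (\<Sum>p\<in>edge_pairs R u v T. edge_term R u v T p))"
        by (simp only: less distrib_left mult.left_commute)
    qed
    also have "\<dots> = (\<Sum>T | T \<subset> S. ?a T * hpol R T) + [:0, 1:] * (\<Sum>p\<in>?P. edge_term R u v S p)"
      by (simp only: sum.distrib sum_distrib_left[symmetric] sum_edge_terms[OF assms 3(3)])
    also have "(\<Sum>T | T \<subset> S. ?a T * hpol R T)
        = hpol R S + [:0, 1:] * (\<Sum>p\<in>?Q. edge_term R u v S p)"
    proof (cases "induced_connected R S")
      case True
      then have "?Q = {}" using no_exhausting_pair[of R S] by blast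
      then show ?thesis by (simp only: hpol_connected[OF True, symmetric] sum.empty mult_zero_right add_0_right)
    next
      case False
      obtain C D where CD: "S = C \<union> D" "?Q = {(C, D)}"
        using bridge_pair[OF assms(1) 3 False] by blast
      then have "(C, D) \<in> edge_pairs R u v S" by blast
      then have CD': "induced_connected R C" "induced_connected R D" "separated R C D"
        by (auto simp: edge_pairs_def)
      have "(\<Sum>p\<in>?Q. edge_term R u v S p) = hpol R C * hpol R D"
        using CD by (simp add: edge_term_def)
      moreover have "hpol R S = hpol R C * hpol R D"
        using hpol_Un[OF assms(1) CD'(3)] CD by simp
      ultimately show ?thesis
        using sum_proper_subsets_separated[OF assms(1) CD'(3,1,2)] CD(1) by simp
    qed
    also have "hpol R S + [:0, 1:] * (\<Sum>p\<in>?Q. edge_term R u v S p)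
          + [:0, 1:] * (\<Sum>p\<in>?P. edge_term R u v S p)
        = hpol R S + [:0, 1:] * ((\<Sum>p\<in>?Q. edge_term R u v S p) + (\<Sum>p\<in>?P. edge_term R u v S p))"
      by (simp only: distrib_left add.assoc)
    also have "(\<Sum>p\<in>?Q. edge_term R u v S p) + (\<Sum>p\<in>?P. edge_term R u v S p)
        = (\<Sum>p\<in>edge_pairs R u v S. edge_term R u v S p)"
      by (subst sum.union_disjoint[symmetric]) (auto intro: sum.cong)
    finally show ?thesis .
  qed
qed

section \<open>Gamma-expansions\<close>

lemma gamma_expansion_add: "gamma_expansion d (g + g') = gamma_expansion d g + gamma_expansion d g'"
  by (simp add: gamma_expansion_def smult_add_left sum.distrib)

lemma gamma_expansion_0 [simp]: "gamma_expansion d 0 = 0"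
  by (simp add: gamma_expansion_def)

lemma gamma_expansion_sum: "gamma_expansion d (\<Sum>i\<in>A. f i) = (\<Sum>i\<in>A. gamma_expansion d (f i))"
  by (induction A rule: infinite_finite_induct) (simp_all add: gamma_expansion_add)

lemma gamma_expansion_monom:
  assumes "i \<le> d div 2"
  shows "gamma_expansion d (monom c i) = smult c (monom 1 i * [:1, 1:] ^ (d - 2 * i))"
proof -
  have "gamma_expansion d (monom c i) =
      (\<Sum>j\<le>d div 2. if i = j then smult c (monom 1 j * [:1, 1:] ^ (d - 2 * j)) else 0)"
    unfolding gamma_expansion_def by (intro sum.cong) auto
  also have "\<dots> = smult c (monom 1 i * [:1, 1:] ^ (d - 2 * i))"
    using assms by (subst sum.delta') auto
  finally show ?thesis .
qed

text \<open>
\<open>gamma_expansion d g\<close> is \<open>(1 + t) ^ d * g(t / (1 + t)\<^sup>2)\<close>, which is multiplicative in the pair \<open>(d, g)\<close>;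
the degree bounds ensure that no monomial is cut off.
\<close>

lemma gamma_expansion_mult:
  assumes "degree g \<le> d div 2" "degree g' \<le> d' div 2"
  shows "gamma_expansion (d + d') (g * g') = gamma_expansion d g * gamma_expansion d' g'"
proof -
  let ?m = "\<lambda>i. monom (coeff g i) i" and ?m' = "\<lambda>j. monom (coeff g' j) j"
  have g: "g = (\<Sum>i\<le>d div 2. ?m i)" and g': "g' = (\<Sum>j\<le>d' div 2. ?m' j)"
    using assms by (simp_all add: poly_as_sum_of_monoms')
  have "gamma_expansion (d + d') (g * g')
      = (\<Sum>i\<le>d div 2. \<Sum>j\<le>d' div 2. gamma_expansion (d + d') (?m i * ?m' j))"
    by (subst g, subst g') (simp only: sum_product gamma_expansion_sum)
  also have "\<dots> = (\<Sum>i\<le>d div 2. \<Sum>j\<le>d' div 2. gamma_expansion d (?m i) * gamma_expansion d' (?m' j))"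
  proof (intro sum.cong refl)
    fix i j assume "i \<in> {..d div 2}" "j \<in> {..d' div 2}"
    then have ij: "i \<le> d div 2" "j \<le> d' div 2" "i + j \<le> (d + d') div 2" by auto
    then have "d + d' - 2 * (i + j) = (d - 2 * i) + (d' - 2 * j)" by auto
    moreover have "monom 1 (i + j) = monom (1::int) i * monom 1 j" by (simp add: mult_monom)
    ultimately show "gamma_expansion (d + d') (?m i * ?m' j)
        = gamma_expansion d (?m i) * gamma_expansion d' (?m' j)"
      by (simp add: gamma_expansion_monom ij mult_monom[of "coeff g i"] power_add mult_ac)
  qed
  also have "\<dots> = gamma_expansion d g * gamma_expansion d' g'"
    by (subst (2) g, subst (2) g') (simp only: sum_product gamma_expansion_sum)
  finally show ?thesis .
qed

definition has_gamma :: "('n::finite) rel \<Rightarrow> 'n set \<Rightarrow> int poly \<Rightarrow> bool" where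
  "has_gamma R S g \<longleftrightarrow> degree g \<le> rk R S div 2 \<and> hpol R S = gamma_expansion (rk R S) g"

definition gam :: "('n::finite) rel \<Rightarrow> 'n set \<Rightarrow> int poly" where
  "gam R S = (THE g. has_gamma R S g)"

lemma gam_eqI: "has_gamma R S g \<Longrightarrow> gam R S = g"
  unfolding gam_def has_gamma_def
  by (intro the_equality) (auto intro: gamma_expansion_inject)

lemma gam_cong: "R \<inter> S \<times> S = R' \<inter> S \<times> S \<Longrightarrow> gam R S = gam R' S"
  using hpol_cong[of R S R'] rk_cong[of R S R'] by (simp add: gam_def has_gamma_def)

definition coeff_le :: "int poly \<Rightarrow> int poly \<Rightarrow> bool" where
  "coeff_le g g' \<longleftrightarrow> (\<forall>i. coeff g i \<le> coeff g' i)"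

lemma coeff_le_refl [simp]: "coeff_le g g"
  by (simp add: coeff_le_def)

lemma coeff_le_trans: "coeff_le f g \<Longrightarrow> coeff_le g h \<Longrightarrow> coeff_le f h"
  by (meson coeff_le_def order_trans)

lemma coeff_le_add: "coeff_le f f' \<Longrightarrow> coeff_le g g' \<Longrightarrow> coeff_le (f + g) (f' + g')"
  by (simp add: coeff_le_def add_mono)

lemma coeff_le_mult:
  "coeff_le f f' \<Longrightarrow> coeff_le g g' \<Longrightarrow> coeff_le 0 f \<Longrightarrow> coeff_le 0 g \<Longrightarrow> coeff_le (f * g) (f' * g')"
  unfolding coeff_le_def coeff_mult
  by (intro allI sum_mono mult_mono) (auto intro: order_trans)

lemma coeff_le_0_mult: "coeff_le 0 f \<Longrightarrow> coeff_le 0 g \<Longrightarrow> coeff_le 0 (f * g)"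
  using coeff_le_mult[of 0 f 0 g] by simp

lemma coeff_le_X_mult: "coeff_le f g \<Longrightarrow> coeff_le ([:0, 1:] * f) ([:0, 1:] * g)"
  by (simp add: coeff_le_def coeff_pCons split: nat.splits)

lemma coeff_le_sum:
  "(\<And>x. x \<in> A \<Longrightarrow> coeff_le (f x) (g x)) \<Longrightarrow> coeff_le (\<Sum>x\<in>A. f x) (\<Sum>x\<in>A. g x)"
  by (simp add: coeff_le_def coeff_sum sum_mono)

lemma coeff_le_sum_subset:
  assumes "finite B" "A \<subseteq> B" "\<And>x. x \<in> A \<Longrightarrow> coeff_le (f x) (g x)" "\<And>x. x \<in> B \<Longrightarrow> coeff_le 0 (g x)"
  shows "coeff_le (\<Sum>x\<in>A. f x) (\<Sum>x\<in>B. g x)"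
proof -
  have "(\<Sum>x\<in>B. g x) = (\<Sum>x\<in>A. g x) + (\<Sum>x\<in>B - A. g x)"
    using assms(1,2) by (metis add.commute sum.subset_diff)
  moreover have "coeff_le 0 (\<Sum>x\<in>B - A. g x)"
    using coeff_le_sum[of "B - A" "\<lambda>_. 0" g] assms(4) by simp
  moreover have "coeff_le (\<Sum>x\<in>A. f x) (\<Sum>x\<in>A. g x)" by (rule coeff_le_sum[OF assms(3)])
  ultimately show ?thesis
    using coeff_le_add[of "\<Sum>x\<in>A. f x" "\<Sum>x\<in>A. g x" 0] by simp
qed

text \<open>
The pairs for which \<open>C \<union> D\<close> is not a union of components; a relation without edges from \<open>C \<union> D\<close> to the
rest of \<open>S\<close> is separated there also after the edge \<open>u v\<close> inside \<open>C \<union> D\<close> has been added.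
\<close>

definition proper_pairs :: "'n rel \<Rightarrow> 'n \<Rightarrow> 'n \<Rightarrow> 'n set \<Rightarrow> ('n set \<times> 'n set) set" where
  "proper_pairs R u v S =
     {p \<in> edge_pairs R u v S. \<not> separated R (fst p \<union> snd p) (S - (fst p \<union> snd p))}"

lemma rk_edge_pair:
  fixes S :: "'n::finite set"
  assumes "(C, D) \<in> edge_pairs R u v S"
  shows "rk R C + rk R D + 2 = card (C \<union> D)"
proof -
  have "induced_connected R C" "induced_connected R D" "C \<noteq> {}" "D \<noteq> {}"
    using assms by (auto simp: edge_pairs_def)
  moreover from this have "card C > 0" "card D > 0" by (auto simp: card_gt_0_iff)
  ultimately show ?thesis
    using card_edge_pair[OF assms] by (simp add: rk_connected)
qed

lemma add_edge_component:
  fixes S :: "'n::finite set"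
  assumes "sym R" "u \<in> S" "v \<in> S"
  obtains A B where "S = A \<union> B" "u \<in> A" "v \<in> A" "induced_connected (add_edge R u v) A"
    "separated (add_edge R u v) A B" "separated R A B" "add_edge R u v \<inter> B \<times> B = R \<inter> B \<times> B"
proof -
  let ?R' = "add_edge R u v"
  obtain A where A: "u \<in> A" "A \<subseteq> S" "induced_connected ?R' A" "separated ?R' A (S - A)"
    using component_exists[OF sym_add_edge[OF assms(1)] assms(2)] by metis
  have "v \<in> A" using A assms(3) by (auto simp: separated_def add_edge_def)
  moreover have "separated R A (S - A)" using A(4) by (auto simp: separated_def add_edge_def)
  moreover have "?R' \<inter> (S - A) \<times> (S - A) = R \<inter> (S - A) \<times> (S - A)"
    using A(1) by (intro add_edge_outside) simp
  ultimately show thesis using that[of A "S - A"] A by blast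
qed

lemma separated_pair_exhausts_component:
  assumes "S = A \<union> B" "separated R A B" "sym R" "induced_connected (add_edge R u v) A"
    "u \<in> A" "v \<in> A" "p \<in> edge_pairs R u v S"
  shows "separated R (fst p \<union> snd p) (S - (fst p \<union> snd p)) \<longleftrightarrow> fst p \<union> snd p = A"
proof -
  obtain C D where p: "p = (C, D)" by (cases p)
  have "p \<in> edge_pairs R u v A"
    using assms(7) edge_pairs_separated_union[OF assms(3,2,5,6)] assms(1) by simp
  then have CD: "C \<subseteq> A" "D \<subseteq> A" "u \<in> C" "v \<in> D" using p by (auto simp: edge_pairs_def)
  have "C \<union> D = A" if sep: "separated R (C \<union> D) (S - (C \<union> D))"
  proof (rule ccontr)
    assume "C \<union> D \<noteq> A"
    then obtain y where "y \<in> A" "y \<notin> C \<union> D" using CD by blast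
    then obtain a b where "(a, b) \<in> add_edge R u v" "a \<in> C \<union> D" "b \<in> A" "b \<notin> C \<union> D"
      using induced_connected_crossing[OF assms(4), of u "C \<union> D" y] CD assms(5) by blast
    then show False using sep CD assms(1) by (auto simp: add_edge_def separated_def)
  qed
  moreover have "separated R A (S - A)" using assms(1,2) by (auto simp: separated_def)
  ultimately show ?thesis using p by auto
qed

text \<open>
Two dimensions are lost: one in splitting \<open>C \<union> D\<close> into \<open>C\<close> and \<open>D\<close>, one in cutting the component into
\<open>C \<union> D\<close> and its complement. Multiplying by \<open>t\<close>, which is \<open>gamma_expansion 2\<close> of itself, restores them.
\<close>

lemma proper_pair_rk:
  fixes S :: "'n::finite set"
  assumes "sym R" "irrefl R" "u \<noteq> v" "(C, D) \<in> proper_pairs R u v S"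
  shows "rk R C + rk R D + rk (contraction (add_edge R u v) (C \<union> D)) (S - (C \<union> D)) + 2
    = rk (add_edge R u v) S"
proof -
  let ?R' = "add_edge R u v"
  define I where "I = C \<union> D"
  let ?K = "contraction ?R' I"
  have CD: "(C, D) \<in> edge_pairs R u v S" using assms(4) by (simp add: proper_pairs_def)
  then have uv: "u \<in> S" "v \<in> S" by (auto simp: edge_pairs_def)
  obtain A B where AB: "S = A \<union> B" "u \<in> A" "v \<in> A" "induced_connected ?R' A"
    "separated ?R' A B" "separated R A B" "?R' \<inter> B \<times> B = R \<inter> B \<times> B"
    using add_edge_component[OF assms(1) uv] by metis
  note sym' = sym_add_edge[OF assms(1), of u v] and irrefl' = irrefl_add_edge[OF assms(2,3)]
  have "I \<noteq> A"
    using separated_pair_exhausts_component[OF AB(1,6) assms(1) AB(4,2,3) CD] assms(4)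
    by (auto simp: proper_pairs_def I_def)
  moreover have "(C, D) \<in> edge_pairs R u v A"
    using CD edge_pairs_separated_union[OF assms(1) AB(6,2,3)] AB(1) by simp
  then have IA: "I \<subseteq> A" by (auto simp: edge_pairs_def I_def)
  ultimately have "induced_connected ?K (A - I)" "card I < card A"
    using contraction_connected[OF sym' irrefl' AB(4)] by (auto intro: psubset_card_mono)
  moreover have "S - I = (A - I) \<union> B" using IA AB(1,6) by (auto simp: separated_def)
  moreover have "rk ?K ((A - I) \<union> B) = rk ?K (A - I) + rk ?K B"
    by (rule rk_Un[OF sym_contraction[OF sym'] contraction_separated(1)[OF sym' AB(5) IA]])
  moreover have "rk ?K B = rk ?R' B"
    using contraction_separated(2)[OF sym' AB(5) IA irrefl'] by (rule rk_cong)
  moreover have "rk ?R' S = rk ?R' A + rk ?R' B" using rk_Un[OF sym' AB(5)] AB(1) by simp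
  moreover have "card (A - I) = card A - card I" using IA by (intro card_Diff_subset) auto
  ultimately show ?thesis
    using rk_edge_pair[OF CD] AB(4) by (simp add: rk_connected I_def)
qed

text \<open>
There is a pair that is not proper iff the new edge joins two components, and then its two sides are
these components.
\<close>

lemma non_proper_pairs:
  fixes S :: "'n::finite set"
  assumes "sym R" "irrefl R" "u \<noteq> v" "u \<in> S" "v \<in> S"
  defines "N \<equiv> edge_pairs R u v S - proper_pairs R u v S"
  shows "N = {} \<and> rk (add_edge R u v) S = rk R S \<or>
    (\<exists>p. N = {p} \<and> edge_term R u v S p = hpol R S) \<and> rk (add_edge R u v) S = rk R S + 1"
proof -
  let ?R' = "add_edge R u v"
  note sym' = sym_add_edge[OF assms(1), of u v] and irrefl' = irrefl_add_edge[OF assms(2,3)]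
  obtain A B where AB: "S = A \<union> B" "u \<in> A" "v \<in> A" "induced_connected ?R' A"
    "separated ?R' A B" "separated R A B" "?R' \<inter> B \<times> B = R \<inter> B \<times> B"
    using add_edge_component[OF assms(1,4,5)] by metis
  have EP: "edge_pairs R u v S = edge_pairs R u v A"
    using edge_pairs_separated_union[OF assms(1) AB(6,2,3)] AB(1) by simp
  have N: "N = {p \<in> edge_pairs R u v A. fst p \<union> snd p = A}"
    using separated_pair_exhausts_component[OF AB(1,6) assms(1) AB(4,2,3)] EP
    by (auto simp: N_def proper_pairs_def)
  have rk': "rk ?R' S = card A - 1 + rk R B"
    using rk_Un[OF sym' AB(5)] AB(1) rk_connected[OF AB(4)] rk_cong[OF AB(7)] by simp
  have rk: "rk R S = rk R A + rk R B" using rk_Un[OF assms(1) AB(6)] AB(1) by simp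
  show ?thesis
  proof (cases "induced_connected R A")
    case True
    then have "N = {}" using no_exhausting_pair[OF True] N by blast
    then show ?thesis using rk' rk rk_connected[OF True] by simp
  next
    case False
    obtain C D where CD: "A = C \<union> D" "N = {(C, D)}"
      using bridge_pair[OF assms(1) AB(2-4) False] N by metis
    then have pair: "(C, D) \<in> edge_pairs R u v A" using N by blast
    then have conn: "induced_connected R C" "induced_connected R D" "separated R C D"
      by (auto simp: edge_pairs_def)
    have "rk R A = rk R C + rk R D" using rk_Un[OF assms(1) conn(3)] CD(1) by simp
    then have "rk ?R' S = rk R S + 1" using rk' rk rk_edge_pair[OF pair] CD(1) by simp
    moreover have "edge_term R u v S (C, D) = hpol R S"
    proof -
      have SA: "S - A = B" using AB(1,6) by (auto simp: separated_def)
      have "contraction ?R' A \<inter> B \<times> B = R \<inter> B \<times> B"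
        using contraction_separated(2)[OF sym' AB(5) order_refl irrefl'] AB(7) by simp
      then have "edge_term R u v S (C, D) = hpol R C * hpol R D * hpol R B"
        using SA hpol_cong[of "contraction ?R' A" B R] by (simp add: edge_term_def CD(1)[symmetric])
      also have "\<dots> = hpol R S"
        using hpol_Un[OF assms(1) AB(6)] hpol_Un[OF assms(1) conn(3)] AB(1) CD(1) by simp
      finally show ?thesis .
    qed
    ultimately show ?thesis using CD(2) by blast
  qed
qed

definition gam_term :: "('n::finite) rel \<Rightarrow> 'n \<Rightarrow> 'n \<Rightarrow> 'n set \<Rightarrow> 'n set \<times> 'n set \<Rightarrow> int poly" where
  "gam_term R u v S = (\<lambda>(C, D). gam R C * gam R D *
     gam (contraction (add_edge R u v) (C \<union> D)) (S - (C \<union> D)))"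

text \<open>
Every factor in the edge formula is replaced by its gamma-expansion. If the edge joins two components,
the summand of the pair that is not proper is \<open>h(R, S)\<close>, and \<open>h(R, S) + t * h(R, S)\<close> is the expansion
of the same polynomial in one dimension more.
\<close>

lemma has_gamma_add_edge:
  fixes S :: "'n::finite set"
  assumes "sym R" "irrefl R" "u \<noteq> v" "u \<in> S" "v \<in> S" "has_gamma R S (gam R S)"
    and pairs: "\<And>C D. (C, D) \<in> proper_pairs R u v S \<Longrightarrow>
      has_gamma R C (gam R C) \<and> has_gamma R D (gam R D) \<and>
      has_gamma (contraction (add_edge R u v) (C \<union> D)) (S - (C \<union> D))
        (gam (contraction (add_edge R u v) (C \<union> D)) (S - (C \<union> D)))"
  shows "has_gamma (add_edge R u v) S
    (gam R S + [:0, 1:] * (\<Sum>p\<in>proper_pairs R u v S. gam_term R u v S p))"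
proof -
  let ?R' = "add_edge R u v"
  let ?d = "rk ?R' S" and ?X = "[:0, 1:] :: int poly"
  let ?N = "edge_pairs R u v S - proper_pairs R u v S"
  have X: "gamma_expansion 2 ?X = ?X"
    using gamma_expansion_monom[of 1 2 1] by (simp add: monom_altdef)
  have one: "gamma_expansion 1 1 = [:1, 1:]"
    using gamma_expansion_monom[of 0 1 1] by (simp add: monom_altdef one_pCons)
  have pair_term: "degree (?X * gam_term R u v S p) \<le> ?d div 2 \<and>
      ?X * edge_term R u v S p = gamma_expansion ?d (?X * gam_term R u v S p)"
    if "p \<in> proper_pairs R u v S" for p
  proof -
    obtain C D where p: "p = (C, D)" by (cases p)
    define K T where "K = contraction ?R' (C \<union> D)" and "T = S - (C \<union> D)"
    have g: "has_gamma R C (gam R C)" "has_gamma R D (gam R D)" "has_gamma K T (gam K T)"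
      using pairs that by (auto simp: p K_def T_def)
    have d: "?d = 2 + (rk R C + rk R D + rk K T)"
      using proper_pair_rk[OF assms(1-3)] that by (simp add: p K_def T_def)
    have deg1: "degree (gam R C * gam R D) \<le> (rk R C + rk R D) div 2"
      using degree_mult_le[of "gam R C" "gam R D"] g by (auto simp: has_gamma_def)
    then have deg: "degree (gam R C * gam R D * gam K T) \<le> (rk R C + rk R D + rk K T) div 2"
      using degree_mult_le[of "gam R C * gam R D" "gam K T"] g by (auto simp: has_gamma_def)
    have "gamma_expansion ?d (?X * (gam R C * gam R D * gam K T))
        = ?X * gamma_expansion (rk R C + rk R D + rk K T) (gam R C * gam R D * gam K T)"
      unfolding d using deg by (subst gamma_expansion_mult) (simp_all only: X, simp)
    also have "\<dots> = ?X * (gamma_expansion (rk R C + rk R D) (gam R C * gam R D) * hpol K T)"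
      using deg1 g by (subst gamma_expansion_mult) (auto simp: has_gamma_def)
    also have "gamma_expansion (rk R C + rk R D) (gam R C * gam R D) = hpol R C * hpol R D"
      using g by (subst gamma_expansion_mult) (auto simp: has_gamma_def)
    finally have "gamma_expansion ?d (?X * gam_term R u v S p) = ?X * edge_term R u v S p"
      by (simp add: gam_term_def edge_term_def p K_def T_def)
    moreover have "degree (?X * gam_term R u v S p) \<le> ?d div 2"
      using deg degree_mult_le[of ?X "gam R C * gam R D * gam K T"] unfolding d
      by (simp add: gam_term_def p K_def T_def)
    ultimately show ?thesis by simp
  qed
  have base: "degree (gam R S) \<le> ?d div 2 \<and>
      hpol R S + ?X * (\<Sum>p\<in>?N. edge_term R u v S p) = gamma_expansion ?d (gam R S)"
    using non_proper_pairs[OF assms(1-5)]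
  proof (elim disjE conjE exE)
    assume N: "?N = {}" "?d = rk R S"
    show ?thesis unfolding N using assms(6) by (simp add: has_gamma_def)
  next
    fix p assume p: "?N = {p}" "edge_term R u v S p = hpol R S" "?d = rk R S + 1"
    have "gamma_expansion ?d (gam R S) = gamma_expansion (1 + rk R S) (1 * gam R S)"
      using p(3) by simp
    also have "\<dots> = [:1, 1:] * hpol R S"
      using assms(6) by (subst gamma_expansion_mult) (simp_all only: has_gamma_def one, simp_all)
    also have "\<dots> = hpol R S + ?X * (\<Sum>p\<in>?N. edge_term R u v S p)"
      by (simp add: p)
    finally have "gamma_expansion ?d (gam R S) = hpol R S + ?X * (\<Sum>p\<in>?N. edge_term R u v S p)" .
    moreover have "degree (gam R S) \<le> rk R S div 2" using assms(6) by (simp add: has_gamma_def)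
    then have "degree (gam R S) \<le> ?d div 2"
      unfolding p(3) by (rule order_trans) (rule div_le_mono, simp)
    ultimately show ?thesis by simp
  qed
  have "hpol ?R' S = hpol R S + ?X * (\<Sum>p\<in>edge_pairs R u v S. edge_term R u v S p)"
    by (rule hpol_add_edge[OF assms(1-3)])
  also have "(\<Sum>p\<in>edge_pairs R u v S. edge_term R u v S p)
      = (\<Sum>p\<in>?N. edge_term R u v S p) + (\<Sum>p\<in>proper_pairs R u v S. edge_term R u v S p)"
    by (rule sum.subset_diff) (auto simp: proper_pairs_def)
  also have "hpol R S + ?X * ((\<Sum>p\<in>?N. edge_term R u v S p)
        + (\<Sum>p\<in>proper_pairs R u v S. edge_term R u v S p))
      = (hpol R S + ?X * (\<Sum>p\<in>?N. edge_term R u v S p))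
        + (\<Sum>p\<in>proper_pairs R u v S. ?X * edge_term R u v S p)"
    by (simp only: distrib_left add.assoc sum_distrib_left)
  also have "\<dots> = gamma_expansion ?d (gam R S)
      + (\<Sum>p\<in>proper_pairs R u v S. gamma_expansion ?d (?X * gam_term R u v S p))"
    using base pair_term by (simp only: cong: sum.cong)
  also have "\<dots> = gamma_expansion ?d
      (gam R S + ?X * (\<Sum>p\<in>proper_pairs R u v S. gam_term R u v S p))"
    by (simp only: gamma_expansion_add gamma_expansion_sum sum_distrib_left)
  finally have "hpol ?R' S = \<dots>" .
  moreover have "degree (gam R S + ?X * (\<Sum>p\<in>proper_pairs R u v S. gam_term R u v S p)) \<le> ?d div 2"
    unfolding sum_distrib_left using base pair_term by (intro degree_add_le degree_sum_le) auto
  ultimately show ?thesis by (simp add: has_gamma_def)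
qed

lemma edge_pairs_smaller:
  fixes S :: "'n::finite set"
  assumes "(C, D) \<in> edge_pairs R u v S"
  shows "card C < card S" "card D < card S" "card (S - (C \<union> D)) < card S"
  using assms by (auto simp: edge_pairs_def separated_def intro!: psubset_card_mono)

text \<open>
Induction on the number of vertices and then on the number of edges, removing one edge with the edge
formula.
\<close>

theorem gam_exists_nonneg:
  fixes S :: "'n::finite set"
  assumes "sym R" "irrefl R"
  shows "has_gamma R S (gam R S) \<and> coeff_le 0 (gam R S)"
  using assms
proof (induction "(card S, card (R \<inter> S \<times> S))" arbitrary: R S
    rule: wf_induct_rule[OF wf_lex_prod[OF wf_less_than wf_less_than]])
  case less: (1 R S)
  show ?case
  proof (cases "R \<inter> S \<times> S = {}")
    case True
    then have one: "has_gamma R S 1"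
      using no_edges_hpol_rk[OF True] gamma_expansion_monom[of 0 0 1]
      by (simp add: has_gamma_def monom_altdef one_pCons)
    then show ?thesis using gam_eqI[OF one] one by (simp add: coeff_le_def)
  next
    case False
    then obtain u v where uv: "(u, v) \<in> R" "u \<in> S" "v \<in> S" by blast
    then have neq: "u \<noteq> v" using less.prems(2) by (auto simp: irrefl_def)
    define R0 where "R0 = R - {(u, v), (v, u)}"
    have R: "R = add_edge R0 u v"
      using uv less.prems(1) by (auto simp: R0_def add_edge_def sym_def)
    have R0: "sym R0" "irrefl R0" using less.prems by (auto simp: R0_def sym_def irrefl_def)
    have "card (R0 \<inter> S \<times> S) < card (R \<inter> S \<times> S)"
      using uv by (intro psubset_card_mono) (auto simp: R0_def)
    then have IH0: "has_gamma R0 S (gam R0 S) \<and> coeff_le 0 (gam R0 S)"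
      using less.hyps[of S R0] R0 by simp
    have smaller: "has_gamma R1 T (gam R1 T) \<and> coeff_le 0 (gam R1 T)"
      if "card T < card S" "sym R1" "irrefl R1" for R1 :: "'n rel" and T
      using less.hyps[of T R1] that by simp
    have pairs: "(has_gamma R0 C (gam R0 C) \<and> coeff_le 0 (gam R0 C)) \<and>
       (has_gamma R0 D (gam R0 D) \<and> coeff_le 0 (gam R0 D)) \<and>
       (has_gamma (contraction R (C \<union> D)) (S - (C \<union> D)) (gam (contraction R (C \<union> D)) (S - (C \<union> D))) \<and>
        coeff_le 0 (gam (contraction R (C \<union> D)) (S - (C \<union> D))))"
      if "(C, D) \<in> proper_pairs R0 u v S" for C D
    proof -
      have "(C, D) \<in> edge_pairs R0 u v S" using that by (simp add: proper_pairs_def)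
      note edge_pairs_smaller[OF this]
      then show ?thesis
        using smaller R0 sym_contraction[OF less.prems(1)] irrefl_contraction[of R] by blast
    qed
    have "has_gamma R S (gam R0 S + [:0, 1:] * (\<Sum>p\<in>proper_pairs R0 u v S. gam_term R0 u v S p))"
      using has_gamma_add_edge[OF R0 neq uv(2,3)] IH0 pairs R by blast
    moreover have "coeff_le 0 (gam_term R0 u v S p)" if "p \<in> proper_pairs R0 u v S" for p
      using pairs that R by (cases p) (auto simp: gam_term_def intro!: coeff_le_0_mult)
    then have "coeff_le 0 (gam R0 S + [:0, 1:] * (\<Sum>p\<in>proper_pairs R0 u v S. gam_term R0 u v S p))"
      using coeff_le_add[of 0 "gam R0 S" 0] IH0 coeff_le_X_mult[of 0]
        coeff_le_sum[of "proper_pairs R0 u v S" "\<lambda>_. 0"] by simp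
    ultimately show ?thesis using gam_eqI by metis
  qed
qed

theorem gam_add_edge:
  fixes S :: "'n::finite set"
  assumes "sym R" "irrefl R" "u \<noteq> v" "u \<in> S" "v \<in> S"
  shows "gam (add_edge R u v) S
    = gam R S + [:0, 1:] * (\<Sum>p\<in>proper_pairs R u v S. gam_term R u v S p)"
  using gam_exists_nonneg[OF assms(1,2)]
    gam_exists_nonneg[OF sym_contraction[OF sym_add_edge[OF assms(1)]] irrefl_contraction]
  by (intro gam_eqI has_gamma_add_edge[OF assms]) blast+

lemma gam_nonneg: "sym R \<Longrightarrow> irrefl R \<Longrightarrow> coeff_le 0 (gam R S)"
  using gam_exists_nonneg by blast

lemma gam_term_nonneg:
  assumes "sym R" "irrefl R"
  shows "coeff_le 0 (gam_term R u v S p)"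
  using assms sym_contraction[OF sym_add_edge[OF assms(1)]] irrefl_contraction
  by (cases p) (auto simp: gam_term_def intro!: coeff_le_0_mult gam_nonneg)

theorem gam_mono:
  fixes S :: "'n::finite set"
  assumes "sym R" "irrefl R" "sym R'" "irrefl R'" "R \<inter> S \<times> S \<subseteq> R'"
  shows "coeff_le (gam R S) (gam R' S)"
  using assms(3-5)
proof (induction "card (R' \<inter> S \<times> S)" arbitrary: R' rule: less_induct)
  case less
  show ?case
  proof (cases "R' \<inter> S \<times> S \<subseteq> R")
    case True
    then have "R \<inter> S \<times> S = R' \<inter> S \<times> S" using less.prems(3) by blast
    then show ?thesis using gam_cong[of R S R'] by simp
  next
    case False
    then obtain u v where uv: "(u, v) \<in> R'" "u \<in> S" "v \<in> S" "(u, v) \<notin> R" by blast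
    then have neq: "u \<noteq> v" using less.prems(2) by (auto simp: irrefl_def)
    define R0 where "R0 = R' - {(u, v), (v, u)}"
    have R': "R' = add_edge R0 u v"
      using uv less.prems(1) by (auto simp: R0_def add_edge_def sym_def)
    have R0: "sym R0" "irrefl R0" using less.prems by (auto simp: R0_def sym_def irrefl_def)
    have "card (R0 \<inter> S \<times> S) < card (R' \<inter> S \<times> S)"
      using uv by (intro psubset_card_mono) (auto simp: R0_def)
    moreover have "R \<inter> S \<times> S \<subseteq> R0"
      using less.prems(3) uv(4) assms(1) by (auto simp: R0_def sym_def)
    ultimately have "coeff_le (gam R S) (gam R0 S)" using less.hyps R0 by blast
    moreover have "coeff_le 0 ([:0, 1:] * (\<Sum>p\<in>proper_pairs R0 u v S. gam_term R0 u v S p))"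
      using coeff_le_X_mult[of 0] coeff_le_sum[of "proper_pairs R0 u v S" "\<lambda>_. 0"]
        gam_term_nonneg[OF R0] by simp
    ultimately have "coeff_le (gam R S + 0) (gam R' S)"
      unfolding R' gam_add_edge[OF R0 neq uv(2,3)] by (rule coeff_le_add)
    then show ?thesis by simp
  qed
qed

section \<open>Relabelling\<close>

lemma induced_connected_image:
  assumes "induced_connected R S"
  shows "induced_connected (map_prod \<pi> \<pi> ` R) (\<pi> ` S)"
proof -
  have "(\<pi> u, \<pi> v) \<in> (map_prod \<pi> \<pi> ` R \<inter> \<pi> ` S \<times> \<pi> ` S)\<^sup>*" if "(u, v) \<in> (R \<inter> S \<times> S)\<^sup>*" for u v
    using that
  proof (induction rule: rtrancl_induct)
    case (step y z)
    then have "(\<pi> y, \<pi> z) \<in> map_prod \<pi> \<pi> ` R \<inter> \<pi> ` S \<times> \<pi> ` S" by force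
    with step.IH show ?case by (rule rtrancl_into_rtrancl)
  qed simp
  then show ?thesis using assms by (auto simp: induced_connected_def)
qed

lemma hpol_rk_image:
  fixes S :: "'n::finite set"
  assumes "inj \<pi>" "sym R"
  shows "hpol (map_prod \<pi> \<pi> ` R) (\<pi> ` S) = hpol R S \<and> rk (map_prod \<pi> \<pi> ` R) (\<pi> ` S) = rk R S"
proof (induction "card S" arbitrary: S rule: less_induct)
  case less
  let ?R = "map_prod \<pi> \<pi> ` R"
  have card: "card (\<pi> ` T) = card T" for T
    using assms(1) by (intro card_image) (auto intro: inj_on_subset)
  have sym': "sym ?R" using assms(2) by (force simp: sym_def)
  consider "S = {}" | "induced_connected R S" | "S \<noteq> {}" "\<not> induced_connected R S" by blast
  then show ?case
  proof cases
    case 1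
    then show ?thesis using no_edges_hpol_rk(2)[of R "{}"] no_edges_hpol_rk(2)[of ?R "{}"] by simp
  next
    case 2
    note conn = induced_connected_image[OF 2, of \<pi>]
    have bij: "bij_betw (image \<pi>) {T. T \<subset> S} {T. T \<subset> \<pi> ` S}"
    proof (rule bij_betw_byWitness[where f' = "vimage \<pi>"])
      show "\<forall>T\<in>{T. T \<subset> S}. \<pi> -` \<pi> ` T = T" using assms(1) by (simp add: inj_vimage_image_eq)
      show "\<forall>T\<in>{T. T \<subset> \<pi> ` S}. \<pi> ` (\<pi> -` T) = T" by auto
      show "image \<pi> ` {T. T \<subset> S} \<subseteq> {T. T \<subset> \<pi> ` S}"
        using assms(1) by (auto simp: inj_image_subset_iff psubset_eq inj_image_eq_iff)
      show "vimage \<pi> ` {T. T \<subset> \<pi> ` S} \<subseteq> {T. T \<subset> S}"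
        using assms(1) by (auto simp: inj_eq)
    qed
    have "hpol ?R (\<pi> ` S) = (\<Sum>T | T \<subset> \<pi> ` S. [:-1, 1:] ^ (card S - card T - 1) * hpol ?R T)"
      by (simp only: hpol_connected[OF conn] card)
    also have "\<dots> = (\<Sum>T | T \<subset> S. [:-1, 1:] ^ (card S - card (\<pi> ` T) - 1) * hpol ?R (\<pi> ` T))"
      by (rule sum.reindex_bij_betw[OF bij, symmetric])
    also have "\<dots> = (\<Sum>T | T \<subset> S. [:-1, 1:] ^ (card S - card T - 1) * hpol R T)"
      using less by (intro sum.cong refl) (simp only: card mem_Collect_eq psubset_card_mono finite)
    also have "\<dots> = hpol R S" by (rule hpol_connected[OF 2, symmetric])
    finally show ?thesis using rk_connected[OF conn] rk_connected[OF 2] card by simp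
  next
    case 3
    obtain A B where AB: "A \<noteq> {}" "B \<noteq> {}" "S = A \<union> B" "separated R A B"
      using not_connected_separation[OF assms(2) 3] by metis
    then have "card A < card S" "card B < card S"
      by (auto simp: separated_def intro!: psubset_card_mono)
    then have IH: "hpol ?R (\<pi> ` A) = hpol R A \<and> rk ?R (\<pi> ` A) = rk R A"
      "hpol ?R (\<pi> ` B) = hpol R B \<and> rk ?R (\<pi> ` B) = rk R B"
      by (intro less; simp)+
    have "separated ?R (\<pi> ` A) (\<pi> ` B)"
      using AB(4) assms(1) by (auto simp: separated_def inj_eq)
    note * = hpol_Un[OF sym' this] rk_Un[OF sym' this]
    show ?thesis
      using * IH hpol_Un[OF assms(2) AB(4)] rk_Un[OF assms(2) AB(4)] AB(3) by (simp add: image_Un)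
  qed
qed

lemma gam_image:
  "inj \<pi> \<Longrightarrow> sym R \<Longrightarrow> gam (map_prod \<pi> \<pi> ` R) (\<pi> ` S) = gam R (S :: 'n::finite set)"
  using hpol_rk_image[of \<pi> R S] by (simp add: gam_def has_gamma_def)

section \<open>Moving a graph along a pendant path\<close>

text \<open>
The vertices \<open>p s, ..., p m\<close> form a path of \<open>Q\<close> which is connected to the rest of \<open>Q\<close> only at \<open>p s\<close>. The
indexing starts at an arbitrary \<open>s\<close> so that a final segment of the path is again such a path for the
same enumeration \<open>p\<close>.
\<close>

definition pendant_path :: "'n rel \<Rightarrow> 'n set \<Rightarrow> (nat \<Rightarrow> 'n) \<Rightarrow> nat \<Rightarrow> nat \<Rightarrow> bool" where
  "pendant_path Q M p s m \<longleftrightarrow> sym Q \<and> irrefl Q \<and> Q \<subseteq> M \<times> M \<and> s \<le> m \<and>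
     inj_on p {s..m} \<and> p ` {s..m} \<subseteq> M \<and>
     (\<forall>i. s \<le> i \<and> i < m \<longrightarrow> (p i, p (Suc i)) \<in> Q) \<and>
     (\<forall>i x. s < i \<and> i \<le> m \<and> (p i, x) \<in> Q \<longrightarrow> x = p (i - 1) \<or> i < m \<and> x = p (Suc i))"

lemma pendant_pathD:
  assumes "pendant_path Q M p s m"
  shows "sym Q" "irrefl Q" "Q \<subseteq> M \<times> M" "s \<le> m" "inj_on p {s..m}" "p ` {s..m} \<subseteq> M"
    and "\<And>i. s \<le> i \<Longrightarrow> i < m \<Longrightarrow> (p i, p (Suc i)) \<in> Q"
    and "\<And>i x. s < i \<Longrightarrow> i \<le> m \<Longrightarrow> (p i, x) \<in> Q \<Longrightarrow> x = p (i - 1) \<or> i < m \<and> x = p (Suc i)"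
  using assms unfolding pendant_path_def by blast+

lemma pendant_path_neighbour:
  assumes "pendant_path Q M p s m" "s < i" "i \<le> m" "(p i, x) \<in> Q"
  shows "x = p (i - 1) \<or> x \<in> p ` {i..m}"
  using pendant_pathD(8)[OF assms] assms(2,3) by auto

text \<open>
Contracting a set that misses the final segment from \<open>t\<close> on can add edges to the vertices
of that segment only at \<open>p t\<close>: the later ones have all their neighbours on the segment.
\<close>

lemma pendant_path_contraction:
  assumes path: "pendant_path Q M p s m"
    and t: "s \<le> t" "t \<le> m" "\<And>i. t \<le> i \<Longrightarrow> i \<le> m \<Longrightarrow> p i \<notin> I"
  shows "pendant_path (contraction Q I) (M - I) p t m"
proof -
  note pp = pendant_pathD[OF path]
  have "x = p (i - 1) \<or> i < m \<and> x = p (Suc i)"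
    if i: "t < i" "i \<le> m" and x: "(p i, x) \<in> contraction Q I" for i x
  proof -
    have nb: "y = p (i - 1) \<or> i < m \<and> y = p (Suc i)" if "(p i, y) \<in> Q" for y
      using pp(8)[of i y] that i t(1) by linarith
    have "p i \<notin> Q `` I"
    proof
      assume "p i \<in> Q `` I"
      then obtain y where y: "y \<in> I" "(p i, y) \<in> Q" using pp(1) by (auto simp: sym_def)
      moreover have "p (i - 1) \<notin> I" using t(3)[of "i - 1"] i by simp
      moreover have "p (Suc i) \<notin> I" if "i < m" using t(3)[of "Suc i"] i that by simp
      ultimately show False using nb[OF y(2)] by blast
    qed
    then have "(p i, x) \<in> Q" using x by (auto simp: contraction_def)
    then show ?thesis by (rule nb)
  qed
  moreover have "(p i, p (Suc i)) \<in> contraction Q I" if "t \<le> i" "i < m" for i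
  proof -
    have "(p i, p (Suc i)) \<in> Q" using pp(7)[of i] that t(1) by simp
    moreover from this have "p i \<noteq> p (Suc i)" using pp(2) by (auto simp: irrefl_def)
    moreover have "p i \<notin> I" "p (Suc i) \<notin> I" using t(3) that by auto
    ultimately show ?thesis by (simp add: contraction_def)
  qed
  moreover have "inj_on p {t..m}" by (rule inj_on_subset[OF pp(5)]) (use t(1) in auto)
  moreover have "p ` {t..m} \<subseteq> M - I"
    using pp(6) t by (auto simp: image_subset_iff)
  moreover have "contraction Q I \<subseteq> (M - I) \<times> (M - I)"
    using pp(1,3) by (auto simp: contraction_def sym_def)
  ultimately show ?thesis
    using t(2) sym_contraction[OF pp(1)] irrefl_contraction[of Q I]
    by (simp add: pendant_path_def)
qed

text \<open>
A graph on \<open>E\<close> together with the vertices \<open>NE\<close> by which it is attached to a vertex outside.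
\<close>

locale side_graph =
  fixes E :: "'n::finite set" and RE :: "'n rel" and NE :: "'n set"
  assumes RE: "sym RE" "irrefl RE" "RE \<subseteq> E \<times> E" and NE: "NE \<subseteq> E"
begin

definition hang :: "'n rel \<Rightarrow> 'n \<Rightarrow> 'n rel" where
  "hang Q x = RE \<union> Q \<union> ({x} \<times> NE \<union> NE \<times> {x})"

lemma sym_hang: "sym Q \<Longrightarrow> sym (hang Q x)"
  using RE(1) by (auto simp: hang_def sym_def)

lemma irrefl_hang: "irrefl Q \<Longrightarrow> x \<notin> E \<Longrightarrow> irrefl (hang Q x)"
  using RE(2) NE by (auto simp: hang_def irrefl_def)

lemma hang_add_edge: "hang (add_edge Q u v) x = add_edge (hang Q x) u v"
  by (auto simp: hang_def add_edge_def)

lemma hang_off_side: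
  assumes "C \<inter> E = {}"
  shows "hang Q x \<inter> C \<times> C = hang Q y \<inter> C \<times> C"
  using assms NE by (auto simp: hang_def)

text \<open>
In the graph with the side graph at \<open>p m\<close>, the only edge that leaves \<open>E\<close> together with the path from
\<open>p i\<close> on goes from \<open>p i\<close> to \<open>p (i - 1)\<close>, so a connected set that meets both sides contains \<open>p (i - 1)\<close>.
\<close>

lemma reaches_back:
  assumes path: "pendant_path Q M p s m" and EM: "E \<inter> M = {}"
    and conn: "induced_connected (hang Q (p m)) C"
    and u: "u \<in> C" "u \<in> M" "u \<notin> p ` {s<..m}"
    and x: "x \<in> C" "x \<in> E \<union> p ` {i..m}" and i: "s < i" "i \<le> m"
  shows "p (i - 1) \<in> C"
proof -
  let ?Z = "E \<union> p ` {i..m}"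
  note pp = pendant_pathD[OF path]
  have "u \<notin> ?Z" using u EM i by auto
  then obtain a b where ab: "(a, b) \<in> hang Q (p m)" "a \<in> C" "a \<in> ?Z" "b \<in> C" "b \<notin> ?Z"
    using induced_connected_crossing[OF conn x u(1)] by blast
  have "(a, b) \<in> Q"
    using ab RE(3) NE i by (auto simp: hang_def)
  moreover from this have "a \<notin> E" using pp(3) EM by blast
  then obtain k where k: "a = p k" "i \<le> k" "k \<le> m" using ab(3) by auto
  ultimately have "b = p (k - 1) \<or> b \<in> p ` {k..m}"
    using pendant_path_neighbour[OF path, of k b] i by auto
  moreover have "p ` {k..m} \<subseteq> ?Z" using k by auto
  ultimately have b: "b = p (k - 1)" using ab(5) by blast
  have "k = i"
  proof (rule ccontr)
    assume "k \<noteq> i"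
    then have "k - 1 \<in> {i..m}" using k by auto
    then show False using b ab(5) by blast
  qed
  then show ?thesis using b ab(4) by simp
qed

lemma contains_initial_path:
  assumes path: "pendant_path Q M p s m" and EM: "E \<inter> M = {}"
    and conn: "induced_connected (hang Q (p m)) C"
    and u: "u \<in> C" "u \<in> M" "u \<notin> p ` {s<..m}"
    and j: "p j \<in> C" "s \<le> j" "j \<le> m"
  shows "p ` {s..j} \<subseteq> C"
proof -
  have "p i \<in> C" if "s \<le> i" "i \<le> j" for i
  proof (cases "i = j")
    case False
    then have "p j \<in> E \<union> p ` {Suc i..m}" "s < Suc i" "Suc i \<le> m" using that j by auto
    then show ?thesis
      using reaches_back[OF path EM conn u j(1), of "Suc i"] by simp
  qed (use j in simp)
  then show ?thesis by auto
qed

lemma contains_path: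
  assumes path: "pendant_path Q M p s m" and "s < m" and EM: "E \<inter> M = {}"
    and conn: "induced_connected (hang Q (p m)) C"
    and u: "u \<in> C" "u \<in> M" "u \<notin> p ` {s<..m}"
    and x: "x \<in> C" "x \<in> E"
  shows "p ` {s..m} \<subseteq> C"
proof -
  have "p i \<in> C" if "s \<le> i" "i < m" for i
    using reaches_back[OF path EM conn u x(1), of "Suc i"] that x(2) by auto
  moreover have "p m \<in> C"
  proof -
    have "u \<notin> E" using u(2) EM by blast
    then obtain a b where "(a, b) \<in> hang Q (p m)" "a \<in> C" "a \<in> E" "b \<in> C" "b \<notin> E"
      using induced_connected_crossing[OF conn x u(1)] by blast
    moreover from this have "(a, b) \<notin> Q" using pendant_pathD(3)[OF path] EM by blast
    ultimately show ?thesis using RE(3) NE by (auto simp: hang_def)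
  qed
  ultimately show ?thesis by (auto simp: le_less)
qed

text \<open>
A set which meets the side graph contains the whole path, so an edge at \<open>p m\<close> that has been moved to \<open>p s\<close>
can be replaced by a walk inside the set.
\<close>

lemma hang_connected_transfer:
  assumes path: "pendant_path Q M p s m" and "s < m" and EM: "E \<inter> M = {}"
    and conn: "induced_connected (hang Q (p m)) C"
    and u: "u \<in> C" "u \<in> M" "u \<notin> p ` {s<..m}"
  shows "induced_connected (hang Q (p s)) C"
proof (cases "C \<inter> E = {}")
  case True
  then show ?thesis using conn induced_connected_cong[OF hang_off_side[OF True]] by blast
next
  case False
  note pp = pendant_pathD[OF path]
  then have P: "p ` {s..m} \<subseteq> C"
    using contains_path[OF path \<open>s < m\<close> EM conn u] False by blast
  let ?T = "(hang Q (p s) \<inter> C \<times> C)\<^sup>*"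
  have symT: "sym ?T"
    using sym_hang[OF pp(1), of "p s"] by (intro sym_rtrancl) (auto simp: sym_def)
  have reach: "(p s, p i) \<in> ?T" if "s \<le> i" "i \<le> m" for i
    using that
  proof (induction i rule: dec_induct)
    case (step i)
    have "(p i, p (Suc i)) \<in> Q" using pp(7) step by simp
    moreover have "p i \<in> C" "p (Suc i) \<in> C" using P step by auto
    ultimately have "(p i, p (Suc i)) \<in> hang Q (p s) \<inter> C \<times> C" by (auto simp: hang_def)
    then show ?case using step by (auto intro: rtrancl_into_rtrancl)
  qed simp
  have "hang Q (p m) \<inter> C \<times> C \<subseteq> ?T"
  proof clarify
    fix x y assume xy: "(x, y) \<in> hang Q (p m)" "x \<in> C" "y \<in> C"
    have ps: "p s \<in> C" using P \<open>s < m\<close> by auto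
    have nb: "(p m, z) \<in> ?T" if "z \<in> NE" "z \<in> C" for z
    proof -
      have "(p s, z) \<in> hang Q (p s) \<inter> C \<times> C" using that ps by (auto simp: hang_def)
      moreover have "(p m, p s) \<in> ?T" using reach[of m] symT \<open>s < m\<close> by (auto dest: symD)
      ultimately show ?thesis by (auto intro: rtrancl_into_rtrancl)
    qed
    consider "(x, y) \<in> RE \<union> Q" | "x = p m" "y \<in> NE" | "y = p m" "x \<in> NE"
      using xy(1) by (auto simp: hang_def)
    then show "(x, y) \<in> ?T"
    proof cases
      case 1
      then show ?thesis using xy by (intro r_into_rtrancl) (auto simp: hang_def)
    next
      case 2
      then show ?thesis using nb xy by blast
    next
      case 3
      then show ?thesis using nb[of x] xy symT by (auto dest: symD)
    qed
  qed
  then have "(hang Q (p m) \<inter> C \<times> C)\<^sup>* \<subseteq> ?T" by (rule rtrancl_subset_rtrancl)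
  then show ?thesis using conn unfolding induced_connected_def by blast
qed

text \<open>
When all edges of \<open>Q\<close> inside \<open>V\<close> belong to the path, the permutation that reverses the path and fixes
all other vertices exchanges the two graphs.
\<close>

lemma reflection_case:
  assumes path: "pendant_path Q M p s m" and EM: "E \<inter> M = {}"
    and V: "p ` {s..m} \<subseteq> V"
    and no_free: "\<And>x y. (x, y) \<in> Q \<Longrightarrow> x \<in> V \<Longrightarrow> y \<in> V \<Longrightarrow> x \<in> p ` {s<..m} \<or> y \<in> p ` {s<..m}"
  shows "gam (hang Q (p m)) V = gam (hang Q (p s)) V"
proof -
  note pp = pendant_pathD[OF path]
  define \<pi> where "\<pi> x = (if x \<in> p ` {s..m} then p (s + m - inv_into {s..m} p x) else x)" for x
  have \<pi>p: "\<pi> (p i) = p (s + m - i)" if "s \<le> i" "i \<le> m" for i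
    using that inv_into_f_f[OF pp(5), of i] by (auto simp: \<pi>_def)
  have \<pi>E: "\<pi> x = x" if "x \<notin> p ` {s..m}" for x using that by (simp add: \<pi>_def)
  have \<pi>\<pi>: "\<pi> (\<pi> x) = x" for x
  proof (cases "x \<in> p ` {s..m}")
    case True
    then obtain i where "x = p i" "s \<le> i" "i \<le> m" by auto
    then show ?thesis using \<pi>p[of i] \<pi>p[of "s + m - i"] by simp
  qed (simp add: \<pi>E)
  have \<pi>V: "\<pi> x \<in> V" if "x \<in> V" for x
  proof (cases "x \<in> p ` {s..m}")
    case True
    then obtain i where i: "x = p i" "s \<le> i" "i \<le> m" by auto
    then have "\<pi> x = p (s + m - i)" using \<pi>p by simp
    moreover have "s + m - i \<in> {s..m}" using i by auto
    ultimately show ?thesis using V by blast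
  qed (simp add: \<pi>E that)
  have Epath: "x \<notin> p ` {s..m}" if "x \<in> E" for x using that EM pp(6) by blast
  have image: "(\<pi> x, \<pi> y) \<in> hang Q (p b)"
    if xy: "(x, y) \<in> hang Q (p a)" "x \<in> V" "y \<in> V" and ab: "s \<le> a" "a \<le> m" "b = s + m - a" for x y a b
  proof -
    consider "(x, y) \<in> RE" | "x = p a" "y \<in> NE" | "x \<in> NE" "y = p a" | "(x, y) \<in> Q"
      using xy(1) by (auto simp: hang_def)
    then show ?thesis
    proof cases
      case 1
      then have "\<pi> x = x" "\<pi> y = y" using RE(3) Epath \<pi>E by blast+
      with 1 show ?thesis by (simp add: hang_def)
    next
      case 2
      then have "\<pi> x = p b" "\<pi> y = y" using \<pi>p[OF ab(1,2)] ab(3) NE Epath \<pi>E by blast+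
      with 2 show ?thesis by (simp add: hang_def)
    next
      case 3
      then have "\<pi> y = p b" "\<pi> x = x" using \<pi>p[OF ab(1,2)] ab(3) NE Epath \<pi>E by blast+
      with 3 show ?thesis by (simp add: hang_def)
    next
      case 4
      have step: "\<exists>i. s \<le> i \<and> i < m \<and> (z = p i \<and> w = p (Suc i) \<or> w = p i \<and> z = p (Suc i))"
        if zw: "(z, w) \<in> Q" "z \<in> p ` {s<..m}" for z w
      proof -
        obtain k where k: "z = p k" "s < k" "k \<le> m" using zw(2) by auto
        consider "w = p (k - 1)" | "k < m" "w = p (Suc k)"
          using pp(8)[OF k(2,3)] zw(1) k(1) by blast
        then show ?thesis
        proof cases
          case 1
          then show ?thesis using k by (intro exI[of _ "k - 1"]) auto
        next
          case 2
          then show ?thesis using k by (intro exI[of _ k]) auto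
        qed
      qed
      have "(y, x) \<in> Q" using 4 pp(1) by (auto dest: symD)
      then obtain i where i: "s \<le> i" "i < m" "x = p i \<and> y = p (Suc i) \<or> y = p i \<and> x = p (Suc i)"
        using no_free[OF 4 xy(2,3)] step[OF 4] step[of y x] by blast
      define k where "k = s + m - Suc i"
      have "s \<le> k" "k < m" "Suc k = s + m - i" using i by (auto simp: k_def)
      then have "(p k, p (Suc k)) \<in> Q" "(p (Suc k), p k) \<in> Q"
        using pp(7)[of k] pp(1) by (auto dest: symD)
      moreover have "\<pi> (p i) = p (Suc k)" "\<pi> (p (Suc i)) = p k"
        using \<pi>p[of i] \<pi>p[of "Suc i"] i \<open>Suc k = s + m - i\<close> by (auto simp: k_def)
      ultimately show ?thesis using i(3) by (auto simp: hang_def)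
    qed
  qed
  let ?R = "hang Q (p s) \<inter> V \<times> V"
  have "map_prod \<pi> \<pi> ` ?R = hang Q (p m) \<inter> V \<times> V"
  proof (intro equalityI subsetI)
    fix z assume "z \<in> map_prod \<pi> \<pi> ` ?R"
    then obtain x y where xy: "(x, y) \<in> hang Q (p s)" "x \<in> V" "y \<in> V" "z = (\<pi> x, \<pi> y)" by auto
    have "(\<pi> x, \<pi> y) \<in> hang Q (p m)" using image[OF xy(1-3), of m] pp(4) by simp
    then show "z \<in> hang Q (p m) \<inter> V \<times> V" using xy \<pi>V by simp
  next
    fix z assume "z \<in> hang Q (p m) \<inter> V \<times> V"
    then obtain x y where xy: "(x, y) \<in> hang Q (p m)" "x \<in> V" "y \<in> V" "z = (x, y)" by auto
    have "(\<pi> x, \<pi> y) \<in> hang Q (p s)" using image[OF xy(1-3), of s] pp(4) by simp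
    then have "(\<pi> x, \<pi> y) \<in> ?R" using xy \<pi>V by simp
    moreover have "z = map_prod \<pi> \<pi> (\<pi> x, \<pi> y)" using xy(4) \<pi>\<pi> by simp
    ultimately show "z \<in> map_prod \<pi> \<pi> ` ?R" by blast
  qed
  moreover have "\<pi> ` V = V"
  proof
    show "\<pi> ` V \<subseteq> V" using \<pi>V by blast
    show "V \<subseteq> \<pi> ` V"
    proof
      fix x assume "x \<in> V"
      then have "\<pi> x \<in> V" by (rule \<pi>V)
      then show "x \<in> \<pi> ` V" using \<pi>\<pi>[of x] by (metis imageI)
    qed
  qed
  moreover have "inj \<pi>" using \<pi>\<pi> by (metis injI)
  moreover have "sym ?R" using sym_hang[OF pp(1), of "p s"] by (auto simp: sym_def)
  ultimately have "gam (hang Q (p m) \<inter> V \<times> V) V = gam ?R V"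
    using gam_image[of \<pi> ?R V] by simp
  moreover have "gam (hang Q (p m) \<inter> V \<times> V) V = gam (hang Q (p m)) V" by (rule gam_cong) blast
  moreover have "gam ?R V = gam (hang Q (p s)) V" by (rule gam_cong) blast
  ultimately show ?thesis by simp
qed

text \<open>
A moved edge could connect \<open>C\<close> with \<open>D\<close>, or the removal of an edge at \<open>p m\<close> could isolate \<open>C \<union> D\<close>. Neither
happens: a set of the pair that meets the side graph or contains \<open>p m\<close> also contains \<open>p s\<close>.
\<close>

lemma proper_pairs_transfer:
  assumes path: "pendant_path Q M p s m" and "s < m" and EM: "E \<inter> M = {}"
    and u: "u \<in> M" "u \<notin> p ` {s<..m}" and v: "v \<in> M" "v \<notin> p ` {s<..m}"
  shows "proper_pairs (hang Q (p m)) u v V \<subseteq> proper_pairs (hang Q (p s)) u v V"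
proof
  fix r assume r: "r \<in> proper_pairs (hang Q (p m)) u v V"
  obtain C D where CD: "r = (C, D)" by (cases r)
  let ?Gm = "hang Q (p m)" and ?Gs = "hang Q (p s)" and ?I = "C \<union> D"
  have C: "C \<subseteq> V" "u \<in> C" "induced_connected ?Gm C"
    and D: "D \<subseteq> V" "v \<in> D" "induced_connected ?Gm D"
    and sep: "separated ?Gm C D" and nsep: "\<not> separated ?Gm ?I (V - ?I)"
    using r CD by (auto simp: proper_pairs_def edge_pairs_def)
  have PC: "p s \<in> C \<and> p m \<in> C" if "x \<in> C" "x \<in> E" for x
    using contains_path[OF path \<open>s < m\<close> EM C(3,2) u that] \<open>s < m\<close> by auto
  have PD: "p s \<in> D \<and> p m \<in> D" if "x \<in> D" "x \<in> E" for x
    using contains_path[OF path \<open>s < m\<close> EM D(3,2) v that] \<open>s < m\<close> by auto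
  have mC: "p s \<in> C" if "p m \<in> C"
    using contains_initial_path[OF path EM C(3,2) u that] \<open>s < m\<close> by auto
  have mD: "p s \<in> D" if "p m \<in> D"
    using contains_initial_path[OF path EM D(3,2) v that] \<open>s < m\<close> by auto
  have disj: "C \<inter> D = {}" using sep by (simp add: separated_def)
  have "(x, y) \<notin> ?Gs" if "x \<in> C" "y \<in> D" for x y
  proof
    assume "(x, y) \<in> ?Gs"
    moreover have "(x, y) \<notin> ?Gm" using sep that by (auto simp: separated_def)
    ultimately consider "x = p s" "y \<in> NE" | "y = p s" "x \<in> NE" by (auto simp: hang_def)
    then show False
    proof cases
      case 1
      then show False using PD[of y] NE that disj by blast
    next
      case 2
      then show False using PC[of x] NE that disj by blast
    qed
  qed
  then have sep': "separated ?Gs C D" using disj by (auto simp: separated_def)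
  obtain x y where xy: "(x, y) \<in> ?Gm" "x \<in> ?I" "y \<in> V" "y \<notin> ?I"
    using nsep by (auto simp: separated_def)
  have "\<exists>x\<in>?I. \<exists>y\<in>V - ?I. (x, y) \<in> ?Gs"
  proof -
    consider "(x, y) \<in> ?Gs" | "x = p m" "y \<in> NE" | "y = p m" "x \<in> NE"
      using xy(1) by (auto simp: hang_def)
    then show ?thesis
    proof cases
      case 1
      then show ?thesis using xy by blast
    next
      case 2
      then have "p s \<in> ?I" using xy(2) mC mD by blast
      moreover have "(p s, y) \<in> ?Gs" using 2 by (simp add: hang_def)
      ultimately show ?thesis using xy by blast
    next
      case 3
      then have "p m \<in> ?I" using xy(2) NE PC[of x] PD[of x] by blast
      then show ?thesis using 3 xy by blast
    qed
  qed
  then have nsep': "\<not> separated ?Gs ?I (V - ?I)" by (auto simp: separated_def)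
  have "induced_connected ?Gs C" "induced_connected ?Gs D"
    using hang_connected_transfer[OF path \<open>s < m\<close> EM] C(2,3) D(2,3) u v by blast+
  then show "r \<in> proper_pairs ?Gs u v V"
    using C D sep' nsep' CD by (simp add: proper_pairs_def edge_pairs_def)
qed

text \<open>
After the contraction only adjacency to \<open>I\<close> matters, and the side graph is attached to \<open>I\<close> either way.
\<close>

lemma hang_contraction_agree:
  assumes "p \<in> I" "q \<in> I"
  shows "contraction (hang Q p) I = contraction (hang Q q) I"
proof -
  have edge: "(x, y) \<in> hang Q p \<longleftrightarrow> (x, y) \<in> hang Q q" if "x \<notin> I" "y \<notin> I" for x y
    using assms that by (auto simp: hang_def)
  have nb: "x \<in> hang Q p `` I \<longleftrightarrow> x \<in> hang Q q `` I" if "x \<notin> I" for x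
    using assms that by (auto simp: hang_def Image_def)
  have "(a, b) \<in> contraction (hang Q p) I \<longleftrightarrow> (a, b) \<in> contraction (hang Q q) I" for a b
    unfolding contraction_def mem_Collect_eq prod.case using edge[of a b] nb[of a] nb[of b] by argo
  then show ?thesis by auto
qed

lemma hang_contraction_avoid:
  assumes "I \<inter> E = {}" "x \<notin> I" "x \<notin> E"
  shows "contraction (hang Q x) I = hang (contraction Q I) x"
proof -
  have nb: "hang Q x `` I - I = Q `` I - I"
  proof -
    have "(RE \<union> ({x} \<times> NE \<union> NE \<times> {x})) `` I = {}" using assms RE(3) NE by auto
    then show ?thesis unfolding hang_def by blast
  qed
  have nbE: "(a, b) \<in> RE \<union> ({x} \<times> NE \<union> NE \<times> {x}) \<Longrightarrow> a \<notin> I \<and> b \<notin> I \<and> a \<noteq> b" for a b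
    using assms RE(2,3) NE by (auto simp: irrefl_def)
  show ?thesis
  proof (intro equalityI subsetI)
    fix z assume "z \<in> contraction (hang Q x) I"
    then show "z \<in> hang (contraction Q I) x"
      using nb by (auto simp: contraction_def hang_def)
  next
    fix z assume z: "z \<in> hang (contraction Q I) x"
    obtain a b where ab: "z = (a, b)" by (cases z)
    show "z \<in> contraction (hang Q x) I"
    proof (cases "z \<in> contraction Q I")
      case True
      then show ?thesis by (auto simp: contraction_def hang_def ab)
    next
      case False
      then have "(a, b) \<in> RE \<union> ({x} \<times> NE \<union> NE \<times> {x})" using z ab by (auto simp: hang_def)
      then show ?thesis using nbE[of a b] ab by (auto simp: contraction_def hang_def)
    qed
  qed
qed

text \<open>
Induction on the number of vertices and then on the number of edges of \<open>Q\<close>. The edge \<open>u v\<close> that is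
removed has both ends off the path or at its first vertex, so that the path stays pendant. The
comparison of the induced subgraphs is \<open>part\<close>, that of the contractions is \<open>quotient\<close>.
\<close>

theorem gam_hang_le:
  assumes "pendant_path Q M p s m" "E \<inter> M = {}" "V \<subseteq> E \<union> M" "p ` {s..m} \<subseteq> V"
  shows "coeff_le (gam (hang Q (p m)) V) (gam (hang Q (p s)) V)"
  using assms
proof (induction "(card V, card (Q \<inter> V \<times> V))" arbitrary: Q M s V
    rule: wf_induct_rule[OF wf_lex_prod[OF wf_less_than wf_less_than]])
  case less: (1 Q V M s)
  note path = less.prems(1) and EM = less.prems(2) and VEM = less.prems(3) and PV = less.prems(4)
  note pp = pendant_pathD[OF path]
  consider "s = m"
    | "s < m" "\<forall>x y. (x, y) \<in> Q \<longrightarrow> x \<in> V \<longrightarrow> y \<in> V \<longrightarrow> x \<in> p ` {s<..m} \<or> y \<in> p ` {s<..m}"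
    | u v where "s < m" "(u, v) \<in> Q" "u \<in> V" "v \<in> V" "u \<notin> p ` {s<..m}" "v \<notin> p ` {s<..m}"
    using pp(4) by (metis le_neq_implies_less)
  then show ?case
  proof cases
    case 1
    then show ?thesis by simp
  next
    case 2
    then show ?thesis using reflection_case[OF path EM PV] by simp
  next
    case uv: 3
    have neq: "u \<noteq> v" using uv(2) pp(2) by (auto simp: irrefl_def)
    have uM: "u \<in> M" "v \<in> M" using uv(2) pp(3) by auto
    define Q0 where "Q0 = Q - {(u, v), (v, u)}"
    have Q: "Q = add_edge Q0 u v" using uv(2) pp(1) by (auto simp: Q0_def add_edge_def sym_def)
    have "(p i, p (Suc i)) \<in> Q0" if "s \<le> i" "i < m" for i
    proof -
      have "p (Suc i) \<in> p ` {s<..m}" using that by auto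
      then show ?thesis using pp(7)[OF that] uv(5,6) by (auto simp: Q0_def)
    qed
    moreover have "sym Q0" "irrefl Q0" "Q0 \<subseteq> M \<times> M"
      using pp(1-3) by (auto simp: Q0_def sym_def irrefl_def)
    moreover have "Q0 \<subseteq> Q" by (auto simp: Q0_def)
    ultimately have path0: "pendant_path Q0 M p s m"
      using pp(4-6,8) unfolding pendant_path_def by blast
    let ?Gm = "hang Q0 (p m)" and ?Gs = "hang Q0 (p s)"
    have pE': "p i \<notin> E" if "s \<le> i" "i \<le> m" for i
    proof -
      have "p i \<in> p ` {s..m}" using that by auto
      then show ?thesis using pp(6) EM by blast
    qed
    then have pE: "p s \<notin> E" "p m \<notin> E" using pp(4) by auto
    have Gm: "sym ?Gm" "irrefl ?Gm" and Gs: "sym ?Gs" "irrefl ?Gs"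
      using sym_hang irrefl_hang pendant_pathD(1,2)[OF path0] pE by auto
    have "card (Q0 \<inter> V \<times> V) < card (Q \<inter> V \<times> V)"
      using uv(2-4) by (intro psubset_card_mono) (auto simp: Q0_def)
    then have base: "coeff_le (gam ?Gm V) (gam ?Gs V)"
      using less.hyps[of V Q0 M s] path0 EM VEM PV by simp
    have part: "coeff_le (gam ?Gm C) (gam ?Gs C)"
      if C: "card C < card V" "C \<subseteq> V" "induced_connected ?Gm C"
        and w: "w \<in> C" "w \<in> M" "w \<notin> p ` {s<..m}" for C w
    proof (cases "C \<inter> E = {}")
      case True
      then show ?thesis using gam_cong[OF hang_off_side[OF True]] coeff_le_refl by metis
    next
      case False
      then have "p ` {s..m} \<subseteq> C"
        using contains_path[OF path0 uv(1) EM C(3) w] by blast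
      then show ?thesis using less.hyps[of C Q0 M s] path0 EM VEM C by auto
    qed
    have quotient: "coeff_le (gam (contraction (hang Q (p m)) (C \<union> D)) (V - (C \<union> D)))
        (gam (contraction (hang Q (p s)) (C \<union> D)) (V - (C \<union> D)))"
      if CD: "(C, D) \<in> edge_pairs ?Gm u v V" for C D
    proof (cases "p m \<in> C \<union> D")
      case True
      have C: "induced_connected ?Gm C" "u \<in> C" and D: "induced_connected ?Gm D" "v \<in> D"
        using CD by (auto simp: edge_pairs_def)
      have "p s \<in> C \<union> D"
        using True contains_initial_path[OF path0 EM C(1,2) uM(1) uv(5), of m]
          contains_initial_path[OF path0 EM D(1,2) uM(2) uv(6), of m] pp(4)
        by (auto simp: image_subset_iff)
      then show ?thesis using hang_contraction_agree[OF True, of "p s" Q] by simp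
    next
      case False
      let ?I = "C \<union> D"
      let ?T = "V - ?I"
      have C: "C \<subseteq> V" "induced_connected ?Gm C" "u \<in> C" and D: "D \<subseteq> V" "induced_connected ?Gm D" "v \<in> D"
        using CD by (auto simp: edge_pairs_def)
      have pm: "p m \<in> p ` {s..m}" using pp(4) by auto
      have "x \<notin> E" if "x \<in> C" for x
        using contains_path[OF path0 uv(1) EM C(2,3) uM(1) uv(5) that] pm False by blast
      moreover have "x \<notin> E" if "x \<in> D" for x
        using contains_path[OF path0 uv(1) EM D(2,3) uM(2) uv(6) that] pm False by blast
      ultimately have IE: "?I \<inter> E = {}" by blast
      have down: "p i \<in> ?I" if "p j \<in> ?I" "s \<le> i" "i \<le> j" "j \<le> m" for i j
        using that contains_initial_path[OF path0 EM C(2,3) uM(1) uv(5), of j]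
          contains_initial_path[OF path0 EM D(2,3) uM(2) uv(6), of j]
        by (auto simp: image_subset_iff)
      \<comment> \<open>the part of the path that is contracted is the one before \<open>t\<close>\<close>
      define t where "t = (LEAST i. s \<le> i \<and> p i \<notin> ?I)"
      have t: "s \<le> t" "p t \<notin> ?I"
        using LeastI[of "\<lambda>i. s \<le> i \<and> p i \<notin> ?I" m] False uv(1) by (auto simp: t_def)
      have tm: "t \<le> m" using Least_le[of "\<lambda>i. s \<le> i \<and> p i \<notin> ?I" m] False uv(1) by (simp add: t_def)
      have before: "p i \<in> ?I" if "s \<le> i" "i < t" for i
        using not_less_Least[of i "\<lambda>i. s \<le> i \<and> p i \<notin> ?I"] that by (auto simp: t_def)
      have after: "p i \<notin> ?I" if "t \<le> i" "i \<le> m" for i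
        using down[of i t] that t by blast
      let ?Q = "contraction Q ?I"
      have patht: "pendant_path ?Q (M - ?I) p t m"
        by (rule pendant_path_contraction[OF path t(1) tm after])
      have "card ?T < card V" using edge_pairs_smaller(3)[OF CD] .
      moreover have "?T \<subseteq> E \<union> (M - ?I)" using VEM by blast
      moreover have "p ` {t..m} \<subseteq> ?T" using after PV t(1) by auto
      moreover have "E \<inter> (M - ?I) = {}" using EM by blast
      ultimately have le: "coeff_le (gam (hang ?Q (p m)) ?T) (gam (hang ?Q (p t)) ?T)"
        using less.hyps[of ?T ?Q "M - ?I" t] patht by simp
      have ptE: "p t \<notin> E" using pE' t(1) tm by auto
      \<comment> \<open>if \<open>p s\<close> is contracted, both \<open>p t\<close> and the attaching vertices of the side graph become neighbours of the contracted set\<close>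
      have "hang ?Q (p t) \<subseteq> contraction (hang Q (p s)) ?I"
      proof (cases "t = s")
        case True
        then show ?thesis using hang_contraction_avoid[OF IE t(2) ptE] by simp
      next
        case False
        then have ps: "p s \<in> ?I" and pt1: "p (t - 1) \<in> ?I" using before t(1) by auto
        have "(p (t - 1), p t) \<in> Q" using pp(7)[of "t - 1"] False t(1) tm by simp
        then have nbt: "p t \<in> hang Q (p s) `` ?I" using pt1 by (auto simp: hang_def)
        have "x \<notin> ?I \<and> x \<noteq> p t \<and> x \<in> hang Q (p s) `` ?I" if "x \<in> NE" for x
          using that NE IE ptE ps by (auto simp: hang_def)
        then have "{p t} \<times> NE \<union> NE \<times> {p t} \<subseteq> contraction (hang Q (p s)) ?I"
          using nbt t(2) by (auto simp: contraction_def)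
        moreover have "RE \<subseteq> contraction (hang Q (p s)) ?I"
          using RE(2,3) IE by (auto simp: contraction_def hang_def irrefl_def)
        moreover have "?Q \<subseteq> contraction (hang Q (p s)) ?I"
          by (auto simp: contraction_def hang_def)
        ultimately show ?thesis by (simp add: hang_def)
      qed
      then have "coeff_le (gam (hang ?Q (p t)) ?T) (gam (contraction (hang Q (p s)) ?I) ?T)"
        using sym_hang irrefl_hang[OF _ ptE] pendant_pathD(1,2)[OF patht]
          sym_contraction[OF sym_hang[OF pp(1)]] irrefl_contraction
        by (intro gam_mono) auto
      with le have "coeff_le (gam (hang ?Q (p m)) ?T) (gam (contraction (hang Q (p s)) ?I) ?T)"
        by (rule coeff_le_trans)
      then show ?thesis by (simp only: hang_contraction_avoid[OF IE False pE(2)])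
    qed
    have "coeff_le (gam_term ?Gm u v V r) (gam_term ?Gs u v V r)"
      if "r \<in> proper_pairs ?Gm u v V" for r
    proof -
      obtain C D where r: "r = (C, D)" by (cases r)
      have CD: "(C, D) \<in> edge_pairs ?Gm u v V" using that r by (simp add: proper_pairs_def)
      then have "induced_connected ?Gm C" "u \<in> C" "induced_connected ?Gm D" "v \<in> D" "C \<subseteq> V" "D \<subseteq> V"
        by (auto simp: edge_pairs_def)
      then have CD_le: "coeff_le (gam ?Gm C) (gam ?Gs C)" "coeff_le (gam ?Gm D) (gam ?Gs D)"
        using part edge_pairs_smaller[OF CD] uM uv(5,6) by blast+
      have nonneg: "coeff_le 0 (gam ?Gm S)" for S by (rule gam_nonneg[OF Gm])
      have "coeff_le 0 (gam (contraction (hang Q (p m)) I) S)" for I S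
        using gam_nonneg sym_contraction[OF sym_hang[OF pp(1)]] irrefl_contraction by blast
      then show ?thesis
        unfolding r gam_term_def prod.case hang_add_edge[symmetric] Q[symmetric]
        by (intro coeff_le_mult quotient[OF CD] CD_le coeff_le_0_mult nonneg)
    qed
    then have "coeff_le (\<Sum>r\<in>proper_pairs ?Gm u v V. gam_term ?Gm u v V r)
        (\<Sum>r\<in>proper_pairs ?Gs u v V. gam_term ?Gs u v V r)"
      using proper_pairs_transfer[OF path0 uv(1) EM uM(1) uv(5) uM(2) uv(6)] gam_term_nonneg[OF Gs]
      by (intro coeff_le_sum_subset) auto
    then have "coeff_le (gam (add_edge ?Gm u v) V) (gam (add_edge ?Gs u v) V)"
      unfolding gam_add_edge[OF Gm neq uv(3,4)] gam_add_edge[OF Gs neq uv(3,4)]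
      by (intro coeff_le_add base coeff_le_X_mult)
    then show ?thesis by (simp only: Q hang_add_edge)
  qed
qed

end

section \<open>Faces of the graph-associahedron\<close>

lemma simplex_on_eq:
  fixes I :: "'n::finite set"
  shows "simplex_on I = {x. (\<forall>i. 0 \<le> x $ i) \<and> (\<forall>i. i \<notin> I \<longrightarrow> x $ i = 0) \<and> (\<Sum>i\<in>I. x $ i) = 1}"
    (is "_ = ?R")
proof
  have "convex ?R"
    by (rule convexI) (auto simp: sum.distrib sum_distrib_left[symmetric])
  moreover have "(\<lambda>i. axis i 1) ` I \<subseteq> ?R"
    by (auto simp: axis_def if_distrib cong: if_cong)
  ultimately show "simplex_on I \<subseteq> ?R" unfolding simplex_on_def by (rule hull_minimal[rotated])
next
  show "?R \<subseteq> simplex_on I"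
  proof
    fix x :: "real ^ 'n" assume x: "x \<in> ?R"
    have "x = (\<Sum>i\<in>I. x $ i *\<^sub>R axis i 1)"
    proof (subst vec_eq_iff, intro allI)
      fix j
      have "(\<Sum>i\<in>I. x $ i *\<^sub>R axis i 1) $ j = (\<Sum>i\<in>I. if i = j then x $ j else 0)"
        unfolding sum_component by (intro sum.cong) (auto simp: axis_def)
      also have "\<dots> = x $ j" using x by (simp add: sum.delta)
      finally show "x $ j = (\<Sum>i\<in>I. x $ i *\<^sub>R axis i 1) $ j" by simp
    qed
    also have "\<dots> \<in> simplex_on I"
      unfolding simplex_on_def using x
      by (intro convex_sum convex_convex_hull) (auto intro: hull_inc)
    finally show "x \<in> simplex_on I" .
  qed
qed

lemma axis_in_simplex_on: "i \<in> I \<Longrightarrow> axis i 1 \<in> simplex_on I"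
  unfolding simplex_on_def by (intro hull_inc) auto

lemma simplex_on_mono: "I \<subseteq> J \<Longrightarrow> simplex_on I \<subseteq> simplex_on J"
  unfolding simplex_on_def by (intro hull_mono) auto

text \<open>
The gap to the maximum is the sum of the non-negative terms \<open>(M - w i) * x $ i\<close>, so it vanishes only if
\<open>x\<close> is supported on the maximizers.
\<close>

lemma simplex_on_value:
  fixes I :: "'n::finite set"
  assumes "x \<in> simplex_on I" "I \<noteq> {}"
  shows "(\<chi> i. w i) \<bullet> x \<le> Max (w ` I)"
    and "(\<chi> i. w i) \<bullet> x = Max (w ` I) \<longleftrightarrow> x \<in> simplex_on (argmax_on w I)"
proof -
  let ?M = "Max (w ` I)"
  have x: "\<And>i. 0 \<le> x $ i" "\<And>i. i \<notin> I \<Longrightarrow> x $ i = 0" "(\<Sum>i\<in>I. x $ i) = 1"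
    using assms(1) by (auto simp: simplex_on_eq)
  have wM: "w i \<le> ?M" if "i \<in> I" for i using that by simp
  have "(\<chi> i. w i) \<bullet> x = (\<Sum>i\<in>UNIV. w i * x $ i)" by (simp add: inner_vec_def)
  also have "\<dots> = (\<Sum>i\<in>I. w i * x $ i)"
    using x(2) by (intro sum.mono_neutral_right) auto
  finally have gap: "?M - (\<chi> i. w i) \<bullet> x = (\<Sum>i\<in>I. (?M - w i) * x $ i)"
    using x(3) by (simp add: left_diff_distrib sum_subtractf sum_distrib_left[symmetric])
  have nonneg: "0 \<le> (?M - w i) * x $ i" if "i \<in> I" for i
    using wM[OF that] x(1)[of i] by simp
  have "0 \<le> (\<Sum>i\<in>I. (?M - w i) * x $ i)" by (intro sum_nonneg nonneg)
  then show "(\<chi> i. w i) \<bullet> x \<le> ?M" using gap by linarith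
  have mem: "i \<in> argmax_on w I \<longleftrightarrow> i \<in> I \<and> w i = ?M" for i
    using wM assms(2) by (auto simp: argmax_on_def intro!: antisym Max.boundedI)
  have "(\<chi> i. w i) \<bullet> x = ?M \<longleftrightarrow> (\<Sum>i\<in>I. (?M - w i) * x $ i) = 0" using gap by auto
  also have "\<dots> \<longleftrightarrow> (\<forall>i\<in>I. (?M - w i) * x $ i = 0)"
    using nonneg by (intro sum_nonneg_eq_0_iff) auto
  also have "\<dots> \<longleftrightarrow> (\<forall>i. i \<notin> argmax_on w I \<longrightarrow> x $ i = 0)"
    unfolding mult_eq_0_iff right_minus_eq mem using x(2) by metis
  also have "\<dots> \<longleftrightarrow> x \<in> simplex_on (argmax_on w I)"
  proof
    assume 0: "\<forall>i. i \<notin> argmax_on w I \<longrightarrow> x $ i = 0"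
    then have "(\<Sum>i\<in>argmax_on w I. x $ i) = (\<Sum>i\<in>I. x $ i)"
      using argmax_on_subset[of w I] by (intro sum.mono_neutral_left) auto
    then show "x \<in> simplex_on (argmax_on w I)" using x 0 by (simp add: simplex_on_eq)
  qed (simp add: simplex_on_eq)
  finally show "(\<chi> i. w i) \<bullet> x = ?M \<longleftrightarrow> x \<in> simplex_on (argmax_on w I)" .
qed

definition family_face :: "('n::finite) rel \<Rightarrow> ('n set \<Rightarrow> 'n set) \<Rightarrow> (real ^ 'n) set" where
  "family_face G \<phi> = (\<Sum>I\<in>building_set G. simplex_on (\<phi> I))"

lemma family_face_iff:
  fixes G :: "('n::finite) rel"
  shows "x \<in> family_face G \<phi> \<longleftrightarrow>
    (\<exists>z. (\<forall>I\<in>building_set G. z I \<in> simplex_on (\<phi> I)) \<and> x = (\<Sum>I\<in>building_set G. z I))"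
  unfolding family_face_def by (subst set_sum_alt) auto

lemma max_family_building:
  "I \<in> building_set G \<Longrightarrow> max_family G UNIV w I = argmax_on w I"
  by (simp add: building_set_def max_family_def)

lemma building_set_nonempty: "I \<in> building_set G \<Longrightarrow> I \<noteq> {}"
  by (auto simp: building_set_def dest: induced_connected_nonempty)

lemma graph_associahedron_family_face:
  "graph_associahedron G = family_face G (max_family G UNIV (\<lambda>_. 0))"
  by (simp add: graph_associahedron_def family_face_def max_family_building cong: sum.cong)

lemma family_choice:
  fixes G :: "('n::finite) rel"
  assumes "\<phi> \<in> max_families G UNIV"
  obtains z where "\<And>I. I \<in> building_set G \<Longrightarrow> z I \<in> simplex_on (\<phi> I)"
proof -
  have "\<exists>x. x \<in> simplex_on (\<phi> I)" if "I \<in> building_set G" for I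
  proof -
    obtain w where "\<phi> = max_family G UNIV w" using assms by (auto simp: max_families_def)
    then have "\<phi> I \<noteq> {}"
      using argmax_on_nonempty[OF building_set_nonempty[OF that], of w] max_family_building[OF that]
      by metis
    then show ?thesis using axis_in_simplex_on by blast
  qed
  then obtain z where "\<And>I. I \<in> building_set G \<Longrightarrow> z I \<in> simplex_on (\<phi> I)" by metis
  then show thesis by (rule that)
qed

text \<open>
A sum of points of the simplices attains the sum of the maxima iff each point attains its maximum.
\<close>

lemma sum_value:
  fixes G :: "('n::finite) rel"
  assumes z: "\<And>I. I \<in> building_set G \<Longrightarrow> z I \<in> simplex_on I"
  shows "(\<chi> i. w i) \<bullet> (\<Sum>I\<in>building_set G. z I) \<le> (\<Sum>I\<in>building_set G. Max (w ` I))"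
    and "(\<chi> i. w i) \<bullet> (\<Sum>I\<in>building_set G. z I) = (\<Sum>I\<in>building_set G. Max (w ` I)) \<longleftrightarrow>
      (\<forall>I\<in>building_set G. z I \<in> simplex_on (max_family G UNIV w I))"
proof -
  let ?v = "\<lambda>I. (\<chi> i. w i) \<bullet> z I"
  have le: "?v I \<le> Max (w ` I)" if "I \<in> building_set G" for I
    using simplex_on_value(1)[OF z building_set_nonempty] that by blast
  have eq: "?v I = Max (w ` I) \<longleftrightarrow> z I \<in> simplex_on (max_family G UNIV w I)"
    if "I \<in> building_set G" for I
    using simplex_on_value(2)[OF z building_set_nonempty] max_family_building that by metis
  show "(\<chi> i. w i) \<bullet> (\<Sum>I\<in>building_set G. z I) \<le> (\<Sum>I\<in>building_set G. Max (w ` I))"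
    unfolding inner_sum_right by (intro sum_mono le)
  have "(\<chi> i. w i) \<bullet> (\<Sum>I\<in>building_set G. z I) = (\<Sum>I\<in>building_set G. Max (w ` I))
      \<longleftrightarrow> (\<Sum>I\<in>building_set G. Max (w ` I) - ?v I) = 0"
    by (auto simp: inner_sum_right sum_subtractf)
  also have "\<dots> \<longleftrightarrow> (\<forall>I\<in>building_set G. Max (w ` I) - ?v I = 0)"
    using le by (intro sum_nonneg_eq_0_iff) auto
  also have "\<dots> \<longleftrightarrow> (\<forall>I\<in>building_set G. z I \<in> simplex_on (max_family G UNIV w I))"
    using eq by (intro ball_cong refl) (metis eq_iff_diff_eq_0)
  finally show "(\<chi> i. w i) \<bullet> (\<Sum>I\<in>building_set G. z I) = (\<Sum>I\<in>building_set G. Max (w ` I)) \<longleftrightarrow>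
      (\<forall>I\<in>building_set G. z I \<in> simplex_on (max_family G UNIV w I))" .
qed

lemma graph_associahedron_iff:
  fixes G :: "('n::finite) rel"
  shows "x \<in> graph_associahedron G \<longleftrightarrow>
    (\<exists>z. (\<forall>I\<in>building_set G. z I \<in> simplex_on I) \<and> x = (\<Sum>I\<in>building_set G. z I))"
  unfolding graph_associahedron_def by (subst set_sum_alt) auto

lemma graph_associahedron_le:
  assumes "x \<in> graph_associahedron G"
  shows "(\<chi> i. w i) \<bullet> x \<le> (\<Sum>I\<in>building_set G. Max (w ` I))"
  using assms sum_value(1)[where G = G and w = w] unfolding graph_associahedron_iff by blast

lemma supporting_face:
  fixes G :: "('n::finite) rel"
  shows "graph_associahedron G \<inter> {x. (\<chi> i. w i) \<bullet> x = (\<Sum>I\<in>building_set G. Max (w ` I))}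
    = family_face G (max_family G UNIV w)"
proof (intro equalityI subsetI)
  fix x assume x: "x \<in> graph_associahedron G \<inter> {x. (\<chi> i. w i) \<bullet> x = (\<Sum>I\<in>building_set G. Max (w ` I))}"
  then obtain z where z: "\<And>I. I \<in> building_set G \<Longrightarrow> z I \<in> simplex_on I" "x = (\<Sum>I\<in>building_set G. z I)"
    by (auto simp: graph_associahedron_iff)
  then show "x \<in> family_face G (max_family G UNIV w)"
    using sum_value(2)[where w = w, OF z(1)] x unfolding family_face_iff by blast
next
  fix x assume "x \<in> family_face G (max_family G UNIV w)"
  then obtain z where z: "\<And>I. I \<in> building_set G \<Longrightarrow> z I \<in> simplex_on (max_family G UNIV w I)"
    "x = (\<Sum>I\<in>building_set G. z I)" by (auto simp: family_face_iff)
  have z': "z I \<in> simplex_on I" if "I \<in> building_set G" for I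
    using z(1)[OF that] simplex_on_mono[OF argmax_on_subset[of w I]]
    unfolding max_family_building[OF that] by blast
  then show "x \<in> graph_associahedron G \<inter> {x. (\<chi> i. w i) \<bullet> x = (\<Sum>I\<in>building_set G. Max (w ` I))}"
    using sum_value(2)[where w = w, OF z'] z by (auto simp: graph_associahedron_iff)
qed

lemma polytope_graph_associahedron: "polytope (graph_associahedron (G :: ('n::finite) rel))"
proof -
  have "finite (\<Sum>I\<in>A. (\<lambda>i. axis i (1::real)) ` (I :: 'n set))" for A :: "'n set set"
    by (induction A rule: infinite_finite_induct) (simp_all add: finite_set_plus)
  then show ?thesis
    unfolding polytope_def graph_associahedron_def simplex_on_def convex_hull_set_sum[symmetric]
    by blast
qed

text \<open>
All faces of a polytope are exposed, and the value of a functional on a non-empty exposed face is the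
maximum over the polytope, which \<open>supporting_face\<close> describes.
\<close>

lemma nonempty_faces:
  fixes G :: "('n::finite) rel"
  shows "{F. F face_of graph_associahedron G \<and> F \<noteq> {}} = family_face G ` max_families G UNIV"
proof (intro equalityI subsetI)
  fix F assume "F \<in> {F. F face_of graph_associahedron G \<and> F \<noteq> {}}"
  then have F: "F exposed_face_of graph_associahedron G" "F \<noteq> {}"
    using exposed_face_of_polyhedron[OF polytope_imp_polyhedron[OF polytope_graph_associahedron]]
    by blast+
  then obtain a b where ab: "graph_associahedron G \<subseteq> {x. a \<bullet> x \<le> b}"
      "F = graph_associahedron G \<inter> {x. a \<bullet> x = b}"
    by (auto simp: exposed_face_of_def)
  define w where "w i = a $ i" for i
  define M where "M = (\<Sum>I\<in>building_set G. Max (w ` I))"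
  have a: "a = (\<chi> i. w i)" by (simp add: w_def vec_eq_iff)
  have face: "graph_associahedron G \<inter> {x. a \<bullet> x = M} = family_face G (max_family G UNIV w)"
    unfolding a M_def by (rule supporting_face)
  obtain z where "\<And>I. I \<in> building_set G \<Longrightarrow> z I \<in> simplex_on (max_family G UNIV w I)"
    using family_choice[of "max_family G UNIV w" G] by (auto simp: max_families_def)
  then have "(\<Sum>I\<in>building_set G. z I) \<in> family_face G (max_family G UNIV w)"
    by (auto simp: family_face_iff)
  then have "M \<le> b" using face ab(1) by auto
  moreover have "b \<le> M"
    using F(2) ab(2) graph_associahedron_le[of _ G w] by (auto simp: a M_def)
  ultimately have "F = family_face G (max_family G UNIV w)" using face ab(2) by simp
  then show "F \<in> family_face G ` max_families G UNIV" by (auto simp: max_families_def)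
next
  fix F assume "F \<in> family_face G ` max_families G UNIV"
  then obtain \<phi> where \<phi>: "\<phi> \<in> max_families G UNIV" "F = family_face G \<phi>" by blast
  then obtain w where w: "\<phi> = max_family G UNIV w" by (auto simp: max_families_def)
  have "F face_of graph_associahedron G"
    unfolding \<phi>(2) w supporting_face[symmetric]
    using graph_associahedron_le polytope_imp_convex[OF polytope_graph_associahedron]
    by (intro face_of_Int_supporting_hyperplane_le) auto
  moreover obtain z where "\<And>I. I \<in> building_set G \<Longrightarrow> z I \<in> simplex_on (\<phi> I)"
    using family_choice[OF \<phi>(1)] by blast
  then have "(\<Sum>I\<in>building_set G. z I) \<in> F" by (auto simp: \<phi>(2) family_face_iff)
  ultimately show "F \<in> {F. F face_of graph_associahedron G \<and> F \<noteq> {}}" by blast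
qed

text \<open>
Replacing the summand from \<open>\<Delta>\<^sub>I\<close> by the unit vector of some \<open>i \<in> \<phi> I\<close> gives a point of the first face,
hence of the second one; then each summand maximizes the functional of the second face, and \<open>i \<in> \<psi> I\<close>.
\<close>

lemma family_face_subset:
  fixes G :: "('n::finite) rel"
  assumes "\<phi> \<in> max_families G UNIV" "\<psi> \<in> max_families G UNIV"
    and "family_face G \<phi> \<subseteq> family_face G \<psi>"
  shows "\<phi> I \<subseteq> \<psi> I"
proof (cases "I \<in> building_set G")
  case False
  then show ?thesis using max_families_eq_empty[OF assms(1), of I] by (auto simp: building_set_def)
next
  case I: True
  show ?thesis
  proof
    fix i assume i: "i \<in> \<phi> I"
    obtain w where w: "\<psi> = max_family G UNIV w" using assms(2) by (auto simp: max_families_def)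
    obtain z where z: "\<And>I. I \<in> building_set G \<Longrightarrow> z I \<in> simplex_on (\<phi> I)"
      using family_choice[OF assms(1)] by metis
    define z' where "z' = z(I := axis i 1)"
    have z': "z' J \<in> simplex_on (\<phi> J)" if "J \<in> building_set G" for J
      using z[OF that] axis_in_simplex_on[OF i] by (auto simp: z'_def)
    then have "(\<Sum>I\<in>building_set G. z' I) \<in> family_face G \<phi>"
      unfolding family_face_iff by blast
    then have "(\<Sum>I\<in>building_set G. z' I) \<in> family_face G \<psi>" using assms(3) by blast
    then have "(\<chi> i. w i) \<bullet> (\<Sum>I\<in>building_set G. z' I) = (\<Sum>I\<in>building_set G. Max (w ` I))"
      unfolding w supporting_face[symmetric] by simp
    moreover have "z' J \<in> simplex_on J" if "J \<in> building_set G" for J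
    proof -
      have "\<phi> J \<subseteq> J" using max_families_subset[OF assms(1)] by blast
      then show ?thesis using z'[OF that] simplex_on_mono by blast
    qed
    ultimately have "z' I \<in> simplex_on (\<psi> I)" using sum_value(2)[where G = G and z = z' and w = w] I w by blast
    then have ax: "axis i 1 \<in> simplex_on (\<psi> I)" by (simp add: z'_def)
    show "i \<in> \<psi> I"
    proof (rule ccontr)
      assume "i \<notin> \<psi> I"
      then have "axis i (1::real) $ i = 0" using ax unfolding simplex_on_eq by blast
      then show False by (simp add: axis_def)
    qed
  qed
qed

lemma inj_on_family_face: "inj_on (family_face G) (max_families G (UNIV :: 'n::finite set))"
proof (rule inj_onI)
  fix \<phi> \<psi> assume *: "\<phi> \<in> max_families G (UNIV :: 'n set)" "\<psi> \<in> max_families G UNIV"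
    "family_face G \<phi> = family_face G \<psi>"
  then have "\<phi> I = \<psi> I" for I
    using family_face_subset[of \<phi> G \<psi> I] family_face_subset[of \<psi> G \<phi> I] by blast
  then show "\<phi> = \<psi>" by blast
qed

lemma simplex_diff_in_span:
  fixes A :: "'n::finite set"
  assumes "x \<in> simplex_on A" "a \<in> A"
  shows "x - axis a 1 \<in> span (unit_diffs A)"
proof -
  have x: "\<And>i. i \<notin> A \<Longrightarrow> x $ i = 0" "(\<Sum>i\<in>A. x $ i) = 1"
    using assms(1) by (auto simp: simplex_on_eq)
  have "x = (\<Sum>i\<in>A. x $ i *\<^sub>R axis i 1)"
  proof (subst vec_eq_iff, intro allI)
    fix j
    have "(\<Sum>i\<in>A. x $ i *\<^sub>R axis i 1) $ j = (\<Sum>i\<in>A. if i = j then x $ j else 0)"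
      unfolding sum_component by (intro sum.cong) (auto simp: axis_def)
    also have "\<dots> = x $ j" using x(1) by (simp add: sum.delta)
    finally show "x $ j = (\<Sum>i\<in>A. x $ i *\<^sub>R axis i 1) $ j" by simp
  qed
  moreover have "axis a 1 = (\<Sum>i\<in>A. x $ i *\<^sub>R axis a (1::real))"
    by (simp add: scaleR_left.sum[symmetric] x(2))
  moreover have "(\<Sum>i\<in>A. x $ i *\<^sub>R (axis i 1 - axis a 1))
      = (\<Sum>i\<in>A. x $ i *\<^sub>R axis i 1) - (\<Sum>i\<in>A. x $ i *\<^sub>R axis a (1::real))"
    by (simp add: scaleR_diff_right sum_subtractf)
  ultimately have "x - axis a 1 = (\<Sum>i\<in>A. x $ i *\<^sub>R (axis i 1 - axis a 1))" by argo
  also have "\<dots> \<in> span (unit_diffs A)"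
    using assms(2) by (intro span_sum span_scale span_base) (auto simp: unit_diffs_def)
  finally show ?thesis .
qed

text \<open>
Changing a single summand from one unit vector to another moves a point of the face by any prescribed
element of \<open>unit_diffs (\<phi> I)\<close>, so these differences span the direction space.
\<close>

lemma aff_dim_family_face:
  fixes G :: "('n::finite) rel"
  assumes "\<phi> \<in> max_families G UNIV"
  shows "aff_dim (family_face G \<phi>) = int (family_dim \<phi>)"
proof -
  let ?B = "building_set G" and ?e = "\<lambda>i. axis i (1::real) :: real ^ 'n"
  define D where "D = (\<Union>I. unit_diffs (\<phi> I))"
  have "\<exists>a. a \<in> \<phi> I" if "I \<in> ?B" for I
  proof -
    obtain w where "\<phi> = max_family G UNIV w" using assms by (auto simp: max_families_def)
    then show ?thesis
      using argmax_on_nonempty[OF building_set_nonempty[OF that], of w] max_family_building[OF that]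
      by (metis ex_in_conv)
  qed
  then obtain a where a: "\<And>I. I \<in> ?B \<Longrightarrow> a I \<in> \<phi> I" by metis
  define b where "b = (\<Sum>I\<in>?B. ?e (a I))"
  have face: "(\<Sum>I\<in>?B. ?e (c I)) \<in> family_face G \<phi>" if "\<And>I. I \<in> ?B \<Longrightarrow> c I \<in> \<phi> I" for c
    unfolding family_face_iff using that by (intro exI[of _ "\<lambda>I. ?e (c I)"]) (auto intro: axis_in_simplex_on)
  have b: "b \<in> family_face G \<phi>" unfolding b_def using a by (rule face)
  let ?T = "(\<lambda>x. x - b) ` family_face G \<phi>"
  have "span ?T = span D"
  proof (rule span_eq[THEN iffD2], intro conjI subsetI)
    fix y assume "y \<in> ?T"
    then obtain x where x: "x \<in> family_face G \<phi>" "y = x - b" by blast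
    from x(1) obtain z where "\<forall>I\<in>?B. z I \<in> simplex_on (\<phi> I)" "x = (\<Sum>I\<in>?B. z I)"
      unfolding family_face_iff by blast
    with x(2) have z: "\<And>I. I \<in> ?B \<Longrightarrow> z I \<in> simplex_on (\<phi> I)" "y = (\<Sum>I\<in>?B. z I) - b"
      by blast+
    have "y = (\<Sum>I\<in>?B. z I - ?e (a I))" by (simp add: z(2) b_def sum_subtractf)
    also have "\<dots> \<in> span D"
    proof (rule span_sum)
      fix I assume I: "I \<in> ?B"
      have "z I - ?e (a I) \<in> span (unit_diffs (\<phi> I))" by (rule simplex_diff_in_span[OF z(1)[OF I] a[OF I]])
      also have "\<dots> \<subseteq> span D" by (intro span_mono) (auto simp: D_def)
      finally show "z I - ?e (a I) \<in> span D" .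
    qed
    finally show "y \<in> span D" .
  next
    fix y assume "y \<in> D"
    then obtain I i j where ij: "i \<in> \<phi> I" "j \<in> \<phi> I" "y = ?e i - ?e j"
      by (auto simp: D_def unit_diffs_def)
    then have I: "I \<in> ?B"
      using max_families_eq_empty[OF assms, of I] by (auto simp: building_set_def)
    have shift: "?e k - ?e (a I) \<in> ?T" if "k \<in> \<phi> I" for k
    proof -
      have "(\<Sum>J\<in>?B. ?e ((a(I := k)) J)) = ?e k + (\<Sum>J\<in>?B - {I}. ?e (a J))"
        using I by (subst sum.remove[of _ I]) (auto intro!: sum.cong)
      moreover have "b = ?e (a I) + (\<Sum>J\<in>?B - {I}. ?e (a J))"
        unfolding b_def using I by (subst sum.remove[of _ I]) auto
      ultimately have "?e k - ?e (a I) = (\<Sum>J\<in>?B. ?e ((a(I := k)) J)) - b" by simp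
      moreover have "(\<Sum>J\<in>?B. ?e ((a(I := k)) J)) \<in> family_face G \<phi>"
        using a that by (intro face) auto
      ultimately show ?thesis by blast
    qed
    have "y = (?e i - ?e (a I)) - (?e j - ?e (a I))" using ij(3) by simp
    also have "\<dots> \<in> span ?T" using shift ij by (intro span_diff span_base)
    finally show "y \<in> span ?T" .
  qed
  then have "dim ?T = dim D" by (metis dim_span)
  moreover have "aff_dim (family_face G \<phi>) = int (dim ?T)"
    using b by (intro aff_dim_eq_dim_subtract hull_inc)
  ultimately show ?thesis by (simp add: family_dim_def D_def)
qed

lemma poly_dim_graph_associahedron: "poly_dim (graph_associahedron G) = rk G (UNIV :: 'n::finite set)"
  using aff_dim_family_face[of "max_family G UNIV (\<lambda>_. 0)" G]
  by (simp add: poly_dim_def graph_associahedron_family_face rk_def max_families_def)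

lemma face_number_graph_associahedron:
  fixes G :: "('n::finite) rel"
  shows "face_number (graph_associahedron G) k = card {\<phi> \<in> max_families G UNIV. family_dim \<phi> = k}"
proof -
  have "{F. F face_of graph_associahedron G \<and> aff_dim F = int k}
      = {F \<in> {F. F face_of graph_associahedron G \<and> F \<noteq> {}}. aff_dim F = int k}" by auto
  also have "\<dots> = family_face G ` {\<phi> \<in> max_families G UNIV. family_dim \<phi> = k}"
    unfolding nonempty_faces using aff_dim_family_face by auto
  finally show ?thesis
    unfolding face_number_def
    by (simp add: card_image[OF inj_on_subset[OF inj_on_family_face]])
qed

lemma family_dim_le_rk:
  fixes G :: "('n::finite) rel"
  assumes "\<phi> \<in> max_families G UNIV"
  shows "family_dim \<phi> \<le> rk G UNIV"
proof -
  have "family_face G \<phi> \<in> {F. F face_of graph_associahedron G \<and> F \<noteq> {}}"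
    unfolding nonempty_faces using assms by blast
  then have "family_face G \<phi> \<subseteq> graph_associahedron G" by (auto dest: face_of_imp_subset)
  then have "aff_dim (family_face G \<phi>) \<le> aff_dim (graph_associahedron G)" by (rule aff_dim_subset)
  then show ?thesis
    using aff_dim_family_face[OF assms] aff_dim_family_face[of "max_family G UNIV (\<lambda>_. 0)" G]
    by (simp add: graph_associahedron_family_face rk_def max_families_def)
qed

lemma f_poly_graph_associahedron:
  fixes G :: "('n::finite) rel"
  shows "f_poly (graph_associahedron G) = (\<Sum>\<phi>\<in>max_families G UNIV. monom 1 (family_dim \<phi>))"
proof -
  let ?\<Phi> = "max_families G UNIV"
  have "monom (int (card {\<phi> \<in> ?\<Phi>. family_dim \<phi> = k})) k
      = (\<Sum>\<phi>\<in>{\<phi> \<in> ?\<Phi>. family_dim \<phi> = k}. monom 1 (family_dim \<phi>))" for k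
  proof -
    have "(\<Sum>\<phi>\<in>{\<phi> \<in> ?\<Phi>. family_dim \<phi> = k}. monom 1 (family_dim \<phi>))
        = (\<Sum>\<phi>\<in>{\<phi> \<in> ?\<Phi>. family_dim \<phi> = k}. monom (1::int) k)"
      by (intro sum.cong) auto
    then show ?thesis by (simp add: of_nat_poly smult_monom)
  qed
  then have "f_poly (graph_associahedron G)
      = (\<Sum>k\<in>{..rk G UNIV}. \<Sum>\<phi>\<in>{\<phi> \<in> ?\<Phi>. family_dim \<phi> = k}. monom 1 (family_dim \<phi>))"
    by (simp add: f_poly_def poly_dim_graph_associahedron face_number_graph_associahedron)
  also have "\<dots> = (\<Sum>\<phi>\<in>?\<Phi>. monom 1 (family_dim \<phi>))"
    using family_dim_le_rk by (intro sum.group) auto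
  finally show ?thesis .
qed

lemma h_poly_graph_associahedron:
  fixes G :: "('n::finite) rel"
  shows "h_poly (graph_associahedron G) = hpol G UNIV"
proof -
  have "pcompose (monom 1 k) [:-1, 1:] = ([:-1, 1:] :: int poly) ^ k" for k
    by (induction k) (simp_all add: monom_Suc pcompose_pCons pcompose_1)
  then show ?thesis
    by (simp add: h_poly_eq f_poly_graph_associahedron pcompose_sum hpol_def)
qed

lemma gamma_poly_graph_associahedron:
  fixes G :: "('n::finite) rel"
  shows "gamma_poly (graph_associahedron G) = gam G UNIV"
  by (simp add: gamma_poly_def gam_def has_gamma_def h_poly_graph_associahedron
      poly_dim_graph_associahedron)

section \<open>Tree shifts\<close>

lemma relpow_path:
  assumes "sym G" "\<And>i. i < m \<Longrightarrow> (p i, p (Suc i)) \<in> G" "d \<le> m"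
  shows "(p m, p (m - d)) \<in> G ^^ d"
  using assms(3)
proof (induction d)
  case (Suc d)
  have "(p (m - Suc d), p (Suc (m - Suc d))) \<in> G" using assms(2)[of "m - Suc d"] Suc.prems by simp
  moreover have "Suc (m - Suc d) = m - d" using Suc.prems by simp
  ultimately have "(p (m - d), p (m - Suc d)) \<in> G" using assms(1) by (auto dest: symD)
  then show ?case using Suc by (auto intro: relpow_Suc_I)
qed simp

lemma neighbour_of_leaf:
  assumes "leaf G v" "(v, a) \<in> G" "(v, b) \<in> G"
  shows "a = b"
proof -
  obtain z where "{w. (v, w) \<in> G} = {z}"
    using assms(1) by (auto simp: leaf_def vertex_degree_def card_1_singleton_iff)
  then have "a \<in> {z}" "b \<in> {z}" using assms(2,3) by blast+
  then show ?thesis by simp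
qed

lemma neighbours_of_degree_le_2:
  fixes G :: "('n::finite) rel"
  assumes "vertex_degree G v \<le> 2" "(v, a) \<in> G" "(v, b) \<in> G" "a \<noteq> b" "(v, x) \<in> G"
  shows "x = a \<or> x = b"
proof -
  have "{a, b} = {w. (v, w) \<in> G}"
    using assms(1-4) by (intro card_seteq) (auto simp: vertex_degree_def)
  then show ?thesis using assms(5) by blast
qed

text \<open>
Suppose that some inner vertex has degree greater than two, and let \<open>p i\<close> be the one closest to \<open>p m\<close>.
Walks from \<open>p m\<close> cannot leave the path before they reach \<open>p i\<close>, so \<open>p i\<close> is closer to \<open>p m\<close> than \<open>p 0\<close> is,
which contradicts the choice of \<open>p 0\<close> as a nearest vertex of degree greater than two.
\<close>

lemma inner_vertices_degree:
  fixes G :: "('n::finite) rel"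
  assumes "sym G" and inj: "inj_on p {0..m}"
    and edge: "\<And>i. i < m \<Longrightarrow> (p i, p (Suc i)) \<in> G"
    and "leaf G (p m)"
    and nearest: "\<And>v. vertex_degree G v > 2 \<Longrightarrow> graph_dist G (p m) (p 0) \<le> graph_dist G (p m) v"
    and i: "0 < i" "i < m"
  shows "vertex_degree G (p i) \<le> 2"
  using i
proof (induction "m - i" arbitrary: i rule: less_induct)
  case less
  have inj': "p a = p b \<longleftrightarrow> a = b" if "a \<le> m" "b \<le> m" for a b
    using inj that by (auto simp: inj_on_eq_iff)
  have prev_edge: "(p (Suc k), p k) \<in> G" if "k < m" for k
    using edge[OF that] assms(1) by (auto dest: symD)
  show ?case
  proof (rule ccontr)
    assume "\<not> vertex_degree G (p i) \<le> 2"
    then have near: "graph_dist G (p m) (p 0) \<le> graph_dist G (p m) (p i)" using nearest by simp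
    have nb: "x \<in> p ` {j - 1..m}" if j: "i < j" "j \<le> m" and x: "(p j, x) \<in> G" for j x
    proof (cases "j = m")
      case True
      have "(p m, p (m - 1)) \<in> G" using prev_edge[of "m - 1"] less.prems by simp
      then have "x = p (m - 1)" using neighbour_of_leaf[OF assms(4)] x True by blast
      then show ?thesis using True by auto
    next
      case False
      have "vertex_degree G (p j) \<le> 2" using less.hyps[of j] j False less.prems by simp
      moreover have "(p j, p (j - 1)) \<in> G" "(p j, p (Suc j)) \<in> G" "p (j - 1) \<noteq> p (Suc j)"
        using prev_edge[of "j - 1"] edge[of j] inj'[of "j - 1" "Suc j"] j False by auto
      ultimately have "x = p (j - 1) \<or> x = p (Suc j)" using x by (rule neighbours_of_degree_le_2)
      then show ?thesis using j False by auto
    qed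
    have reach: "y \<in> p ` {m - k..m}" if "(p m, y) \<in> G ^^ k" "k \<le> m - i" for k y
      using that
    proof (induction k arbitrary: y)
      case (Suc k)
      then obtain z where z: "(p m, z) \<in> G ^^ k" "(z, y) \<in> G" by auto
      have "z \<in> p ` {m - k..m}" using Suc.IH[OF z(1)] Suc.prems(2) by simp
      then obtain j where j: "z = p j" "m - k \<le> j" "j \<le> m" by auto
      then have "y \<in> p ` {j - 1..m}" using nb[of j y] z(2) Suc.prems(2) less.prems by simp
      moreover have "{j - 1..m} \<subseteq> {m - Suc k..m}" using j by auto
      ultimately show ?case by blast
    qed simp
    have "(p m, p 0) \<in> G ^^ graph_dist G (p m) (p 0)"
      unfolding graph_dist_def using relpow_path[of G m p m] assms(1) edge by (intro LeastI) auto
    moreover have "graph_dist G (p m) (p i) \<le> m - i"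
      unfolding graph_dist_def using relpow_path[of G m p "m - i"] assms(1) edge less.prems
      by (intro Least_le) auto
    ultimately have "p 0 \<in> p ` {m - graph_dist G (p m) (p 0)..m}"
        and d: "graph_dist G (p m) (p 0) \<le> m - i"
      using reach near by auto
    then obtain j where "j \<le> m" "m - graph_dist G (p m) (p 0) \<le> j" "p 0 = p j" by auto
    then show False using inj'[of 0 j] d less.prems by auto
  qed
qed

text \<open>
The inner vertices have degree two and the last one is a leaf, so the path has no edges to the rest of
the graph except at \<open>c\<close>.
\<close>

lemma tree_shift_pendant_path:
  fixes G :: "('n::finite) rel"
  assumes "sym G" "irrefl G" and data: "tree_shift_data G c cs l F"
  defines "p \<equiv> (\<lambda>i. (c # cs @ [l]) ! i)" and "m \<equiv> Suc (length cs)"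
  shows "pendant_path (G \<inter> (- F) \<times> (- F)) (- F) p 0 m"
proof -
  let ?xs = "c # cs @ [l]"
  have len: "length ?xs = Suc m" by (simp add: m_def)
  have path: "distinct ?xs" "successively (\<lambda>u v. (u, v) \<in> G) ?xs" and leaf: "leaf G l"
    and nearest: "\<And>v. vertex_degree G v > 2 \<Longrightarrow> graph_dist G l c \<le> graph_dist G l v"
    and disj: "F \<inter> set ?xs = {}"
    using data unfolding tree_shift_data_def graph_path_def by blast+
  have ends: "p 0 = c" "p m = l" by (simp_all add: p_def m_def)
  have edge: "(p i, p (Suc i)) \<in> G" if "i < m" for i
    using path(2) that len unfolding successively_conv_nth p_def by simp
  have inj: "inj_on p {0..m}"
    using path(1) len unfolding p_def by (intro inj_onI) (simp add: nth_eq_iff_index_eq)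
  have inF: "p i \<notin> F" if "i \<le> m" for i
  proof -
    have "p i \<in> set ?xs" unfolding p_def using that len by (intro nth_mem) simp
    then show ?thesis using disj by blast
  qed
  have nb: "x = p (i - 1) \<or> i < m \<and> x = p (Suc i)" if i: "0 < i" "i \<le> m" and x: "(p i, x) \<in> G" for i x
  proof -
    have prev_edge: "(p i, p (i - 1)) \<in> G" using edge[of "i - 1"] i assms(1) by (simp add: sym_def)
    show ?thesis
    proof (cases "i = m")
      case True
      then show ?thesis
        using neighbour_of_leaf[OF leaf, of x "p (i - 1)"] prev_edge x ends by simp
    next
      case False
      have "vertex_degree G (p i) \<le> 2"
        using inner_vertices_degree[OF assms(1) inj edge] leaf nearest ends i False by simp
      moreover have "p (i - 1) \<noteq> p (Suc i)" using inj i False by (auto simp: inj_on_eq_iff)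
      ultimately show ?thesis
        using neighbours_of_degree_le_2[of G "p i" "p (i - 1)" "p (Suc i)" x] prev_edge edge[of i] x i False
        by auto
    qed
  qed
  have "sym (G \<inter> (- F) \<times> (- F))" "irrefl (G \<inter> (- F) \<times> (- F))"
    using assms(1,2) by (auto simp: sym_def irrefl_def)
  then show ?thesis
    unfolding pendant_path_def using inj inF edge nb by (auto simp: image_subset_iff)
qed

text \<open>
The subgraph on \<open>F\<close> is the side graph. It is attached to the rest of \<open>G\<close> at \<open>c\<close> only, and the shift moves it
from the first vertex \<open>c\<close> of the pendant path to the last vertex \<open>l\<close>.
\<close>

theorem theorem4p1:
  fixes G G' :: "('n::finite) rel"
  assumes "simple_graph G" and "connected_graph G"
    and "tree_shift G G'"
  shows "\<forall>i. coeff (gamma_poly (graph_associahedron G')) i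
           \<le> coeff (gamma_poly (graph_associahedron G)) i"
proof -
  have G: "sym G" "irrefl G" using assms(1) by (auto simp: simple_graph_def)
  obtain c cs l F where data: "tree_shift_data G c cs l F" and G': "G' = shift_edges G c l F"
    using assms(3) by (auto simp: tree_shift_def)
  define p where "p = (\<lambda>i. (c # cs @ [l]) ! i)"
  define m where "m = Suc (length cs)"
  define NE where "NE = {v \<in> F. (v, c) \<in> G}"
  let ?Q = "G \<inter> (- F) \<times> (- F)"
  have path: "pendant_path ?Q (- F) p 0 m"
    unfolding p_def m_def by (rule tree_shift_pendant_path[OF G data])
  have ends: "p 0 = c" "p m = l" by (simp_all add: p_def m_def)
  have cF: "c \<notin> F" and attach: "\<And>u v. u \<notin> insert c F \<Longrightarrow> v \<in> F \<Longrightarrow> (u, v) \<notin> G"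
    using data unfolding tree_shift_data_def by auto
  interpret side_graph F "G \<inter> F \<times> F" NE
    using G by unfold_locales (auto simp: sym_def irrefl_def NE_def)
  have cross: "u = c" if "(u, v) \<in> G \<or> (v, u) \<in> G" "u \<notin> F" "v \<in> F" for u v
    using attach[of u v] that G(1) by (auto dest: symD)
  have "hang ?Q c = G"
    unfolding hang_def using cross G(1) cF by (auto simp: NE_def dest: symD)
  moreover have "hang ?Q l = G'"
    unfolding hang_def G' shift_edges_def using cross G(1) cF by (auto simp: NE_def dest: symD)
  ultimately have "coeff_le (gam G' UNIV) (gam G UNIV)"
    using gam_hang_le[OF path, of UNIV] ends by auto
  then show ?thesis by (simp add: coeff_le_def gamma_poly_graph_associahedron)
qed

end
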